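(* For any $(nd,s,\Delta,w)$-arithmetic circuit $\mathcal{C}$, there exists an equivalent $(N,\Delta',d,N',d')$-BaseConv model with $N=n$, $\Delta'=\mathcal{O}(\Delta\log w)$, $N'=\mathcal{O}(w)$ and $d'=d$ that simulates $\mathcal{C}$ (i.e. on input $u\in\mathbb{R}^{n\times d}$, whose $nd$ entries are the inputs of the circuit, the model computes the output of $\mathcal{C}$).
   Context: Arithmetic circuits. An arithmetic circuit over a field (here $\mathbb{R}$) with variables $x_1,\dots,x_m$ is a directed acyclic graph whose input nodes are labelled by variables or field constants and whose internal nodes are labelled by $+$ or $\times$; it computes the polynomial(s) at its output node(s). Its size is the number of nodes, its depth is the length of the longest path from an input node to an output node, and its width is the number of parallel operations, i.e. of wires intersected by a horizontal cut through the circuit. An $(m,s,\Delta,w)$-arithmetic circuit is an $m$-variate arithmetic circuit of size $s$, depth at most $\Delta$ and width $w$. Kaleidoscope matrices. For $k\ge 2$ a power of 2, a butterfly factor of size $k$ is a matrix $\begin{bmatrix} D_1 & D_2 \\ D_3 & D_4 \end{bmatrix}$ with each $D_i$ a $\frac k2\times\frac k2$ diagonal matrix. A butterfly factor matrix $B^{(n)}_k$ is an $n\times n$ block diagonal matrix of $n/k$ (possibly different) butterfly factors of size $k$. A butterfly matrix of size $n$ is a product $B^{(n)}=B^{(n)}_nB^{(n)}_{n/2}\cdots B^{(n)}_2$. Let $\mathcal{B}$ be the set of butterfly matrices; $(\mathcal{B}\mathcal{B}^* )$ the set of matrices $M_1M_2^*$ with $M_1,M_2\in\mathcal{B}$; $(\mathcal{B}\mathcal{B}^*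 )^{w}$ the set of products of $w$ matrices from $(\mathcal{B}\mathcal{B}^* )$; and $(\mathcal{B}\mathcal{B}^* )^{w}_{e}$ the set of $n\times n$ matrices $SES^\top$ with $E\in(\mathcal{B}\mathcal{B}^* )^{w}$ of size $en\times en$ and $S=[I_n\ 0\ \cdots\ 0]\in\mathbb{R}^{n\times en}$. BaseConv. A BaseConv layer maps $u\in\mathbb{R}^{N'\times d'}$ to $(uW+b_1)\odot(h\ast u+b_2)$, where $W\in\mathbb{R}^{d'\times d'}$ belongs to $(\mathcal{B}\mathcal{B}^* )^{\mathrm{poly}\log d'}_{\mathrm{poly}\log d'}$, $h,b_1,b_2\in\mathbb{R}^{N'\times d'}$, $\odot$ is the entrywise product, and $h\ast u$ is the column-wise convolution (product of the polynomials whose coefficients are the columns, taken modulo $X^{N'}$; circular convolution, modulo $X^{N'}-1$, is also allowed). An $(N,L,d,N',d')$-BaseConv model takes $u\in\mathbb{R}^{N\times d}$, embeds it as the top-left block of an otherwise zero $N'\times d'$ matrix, applies $L$ BaseConv layers (each with its own parameters), and outputs the top-left $N\times d$ block of the result. *)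

theory Defs
  imports
    "Graph_Theory.Arc_Walk"
    "Jordan_Normal_Form.Matrix"
    "HOL-Computational_Algebra.Polynomial"
    "HOL-Library.Landau_Symbols"
begin

section \<open>Arithmetic circuits\<close>

datatype node_label = Var nat | Const real | Add | Mult

text \<open>
  A multigraph, so that a gate may use the same argument several times (as in \<open>x * x\<close>).
  Nodes and wires are natural numbers: every finite circuit has such a copy, and the constants
  hidden in an asymptotic bound cannot then depend on the node type.
\<close>

record arith_circuit =
  graph :: "(nat, nat) pre_digraph"
  label :: "nat \<Rightarrow> node_label"
  outputs :: "nat list"

definition is_input :: "arith_circuit \<Rightarrow> nat \<Rightarrow> bool" where
  "is_input C v \<longleftrightarrow> v \<in> verts (graph C) \<and> ((\<exists>i. label C v = Var i) \<or> (\<exists>c. label C v = Const c))"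

definition circuit_in_vars :: "nat \<Rightarrow> arith_circuit \<Rightarrow> bool" where
  "circuit_in_vars m C \<longleftrightarrow>
     fin_digraph (graph C) \<and>
     (\<nexists>p. pre_digraph.cycle (graph C) p) \<and>
     (\<forall>v\<in>verts (graph C). is_input C v \<longleftrightarrow> in_arcs (graph C) v = {}) \<and>
     (\<forall>v\<in>verts (graph C). \<forall>i. label C v = Var i \<longrightarrow> i < m) \<and>
     outputs C \<noteq> [] \<and> set (outputs C) \<subseteq> verts (graph C)"

text \<open>The polynomials of a circuit enter only through their values; over the reals these determine
  them. Fan-in is not bounded.\<close>

inductive node_value :: "arith_circuit \<Rightarrow> (nat \<Rightarrow> real) \<Rightarrow> nat \<Rightarrow> real \<Rightarrow> bool"
  for C :: arith_circuit and x :: "nat \<Rightarrow> real" where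
  var: "v \<in> verts (graph C) \<Longrightarrow> label C v = Var i \<Longrightarrow> node_value C x v (x i)"
| const: "v \<in> verts (graph C) \<Longrightarrow> label C v = Const c \<Longrightarrow> node_value C x v c"
| add: "v \<in> verts (graph C) \<Longrightarrow> label C v = Add \<Longrightarrow>
    (\<forall>a\<in>in_arcs (graph C) v. node_value C x (tail (graph C) a) (f a)) \<Longrightarrow>
    node_value C x v (\<Sum>a\<in>in_arcs (graph C) v. f a)"
| mult: "v \<in> verts (graph C) \<Longrightarrow> label C v = Mult \<Longrightarrow>
    (\<forall>a\<in>in_arcs (graph C) v. node_value C x (tail (graph C) a) (f a)) \<Longrightarrow>
    node_value C x v (\<Prod>a\<in>in_arcs (graph C) v. f a)"

definition circuit_output :: "arith_circuit \<Rightarrow> (nat \<Rightarrow> real) \<Rightarrow> real list" where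
  "circuit_output C x = map (\<lambda>v. THE r. node_value C x v r) (outputs C)"

definition circuit_size :: "arith_circuit \<Rightarrow> nat" where
  "circuit_size C = card (verts (graph C))"

definition node_level :: "arith_circuit \<Rightarrow> nat \<Rightarrow> nat" where
  "node_level C v = Max {length p | u p. is_input C u \<and> pre_digraph.awalk (graph C) u p v}"

definition circuit_depth :: "arith_circuit \<Rightarrow> nat" where
  "circuit_depth C = Max {length p | u p v.
     is_input C u \<and> v \<in> set (outputs C) \<and> pre_digraph.awalk (graph C) u p v}"

text \<open>The wires met by the horizontal cut between levels \<open>t\<close> and \<open>t + 1\<close> when the circuit is drawn
  with every node at the height given by its level.\<close>

definition cut_wires :: "arith_circuit \<Rightarrow> nat \<Rightarrow> nat set" where
  "cut_wires C t = {a \<in> arcs (graph C).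
     node_level C (tail (graph C) a) \<le> t \<and> t < node_level C (head (graph C) a)}"

text \<open>The element \<open>m\<close> stands for the cut just below the input nodes, which meets the \<open>m\<close> wires on which the
  variables enter the circuit, whether or not a gate uses them.\<close>

definition circuit_width :: "nat \<Rightarrow> arith_circuit \<Rightarrow> nat" where
  "circuit_width m C = Max (insert m (range (\<lambda>t. card (cut_wires C t))))"

definition arithmetic_circuit ::
    "nat \<Rightarrow> nat \<Rightarrow> nat \<Rightarrow> nat \<Rightarrow> arith_circuit \<Rightarrow> bool" where
  "arithmetic_circuit m s \<Delta> w C \<longleftrightarrow>
     circuit_in_vars m C \<and> circuit_size C = s \<and> circuit_depth C \<le> \<Delta> \<and> circuit_width m C = w"


section \<open>Kaleidoscope matrices\<close>

definition butterfly_factor :: "nat \<Rightarrow> real mat \<Rightarrow> bool" where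
  "butterfly_factor k M \<longleftrightarrow>
     (\<exists>D1 D2 D3 D4. {D1, D2, D3, D4} \<subseteq> carrier_mat (k div 2) (k div 2) \<and>
        (\<forall>D\<in>{D1, D2, D3, D4}. diagonal_mat D) \<and> M = four_block_mat D1 D2 D3 D4)"

definition butterfly_factor_matrix :: "nat \<Rightarrow> nat \<Rightarrow> real mat \<Rightarrow> bool" where
  "butterfly_factor_matrix n k M \<longleftrightarrow>
     (\<exists>Fs. length Fs = n div k \<and> (\<forall>F\<in>set Fs. butterfly_factor k F) \<and> M = diag_block_mat Fs)"

definition mat_prod_list :: "nat \<Rightarrow> real mat list \<Rightarrow> real mat" where
  "mat_prod_list n Ms = foldr (*) Ms (1\<^sub>m n)"

definition butterfly :: "nat \<Rightarrow> real mat set" where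
  "butterfly n = {mat_prod_list n Bs | Bs r. n = 2 ^ r \<and> length Bs = r \<and>
     (\<forall>i<r. butterfly_factor_matrix n (n div 2 ^ i) (Bs ! i))}"

text \<open>For real matrices the adjoint is the transpose.\<close>

definition BBstar :: "nat \<Rightarrow> real mat set" where
  "BBstar n = {M1 * transpose_mat M2 | M1 M2. M1 \<in> butterfly n \<and> M2 \<in> butterfly n}"

definition BBstar_power :: "nat \<Rightarrow> nat \<Rightarrow> real mat set" where
  "BBstar_power n w = {mat_prod_list n Ms | Ms. length Ms = w \<and> set Ms \<subseteq> BBstar n}"

text \<open>Butterfly matrices exist only in sizes that are powers of two, so the inner size \<open>e * n\<close> is
  rounded up to the next one; nothing changes if \<open>e * n\<close> already is a power of two.\<close>

definition pow2_ceil :: "nat \<Rightarrow> nat" where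
  "pow2_ceil k = 2 ^ (LEAST r. k \<le> 2 ^ r)"

definition kaleidoscope :: "nat \<Rightarrow> nat \<Rightarrow> nat \<Rightarrow> real mat set" where
  "kaleidoscope n w e = {S * E * transpose_mat S | S E. 1 \<le> e \<and>
     S = mat n (pow2_ceil (e * n)) (\<lambda>(i, j). if i = j then 1 else 0) \<and>
     E \<in> BBstar_power (pow2_ceil (e * n)) w}"

definition polylog :: "(nat \<Rightarrow> nat) \<Rightarrow> bool" where
  "polylog f \<longleftrightarrow> (\<exists>a::nat. (\<lambda>n. real (f n)) \<in> O(\<lambda>n. ln (real n) ^ a))"


section \<open>BaseConv models\<close>

datatype conv_type = Truncated | Circular

fun conv_modulus :: "conv_type \<Rightarrow> nat \<Rightarrow> real poly" where
  "conv_modulus Truncated N = monom 1 N"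
| "conv_modulus Circular N = monom 1 N - 1"

definition col_poly :: "real mat \<Rightarrow> nat \<Rightarrow> real poly" where
  "col_poly A j = (\<Sum>i<dim_row A. monom (A $$ (i, j)) i)"

definition column_conv :: "conv_type \<Rightarrow> real mat \<Rightarrow> real mat \<Rightarrow> real mat" where
  "column_conv c h u = mat (dim_row u) (dim_col u)
     (\<lambda>(i, j). coeff ((col_poly h j * col_poly u j) mod conv_modulus c (dim_row u)) i)"

definition hadamard :: "real mat \<Rightarrow> real mat \<Rightarrow> real mat" where
  "hadamard A B = mat (dim_row A) (dim_col A) (\<lambda>ij. A $$ ij * B $$ ij)"

record baseconv_layer =
  conv_kind :: conv_type
  weight :: "real mat"
  kernel :: "real mat"
  bias1 :: "real mat"
  bias2 :: "real mat"

text \<open>The functions \<open>\<omega>\<close> and \<open>\<epsilon>\<close> give the width and expansion of the weight matrices.\<close>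

definition is_baseconv_layer ::
    "(nat \<Rightarrow> nat) \<Rightarrow> (nat \<Rightarrow> nat) \<Rightarrow> nat \<Rightarrow> nat \<Rightarrow> baseconv_layer \<Rightarrow> bool" where
  "is_baseconv_layer \<omega> \<epsilon> N' d' l \<longleftrightarrow>
     weight l \<in> kaleidoscope d' (\<omega> d') (\<epsilon> d') \<and>
     {kernel l, bias1 l, bias2 l} \<subseteq> carrier_mat N' d'"

definition apply_layer :: "baseconv_layer \<Rightarrow> real mat \<Rightarrow> real mat" where
  "apply_layer l u =
     hadamard (u * weight l + bias1 l) (column_conv (conv_kind l) (kernel l) u + bias2 l)"

definition is_baseconv_model ::
    "(nat \<Rightarrow> nat) \<Rightarrow> (nat \<Rightarrow> nat) \<Rightarrow> nat \<Rightarrow> nat \<Rightarrow> nat \<Rightarrow> nat \<Rightarrow> nat \<Rightarrow>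
     baseconv_layer list \<Rightarrow> bool" where
  "is_baseconv_model \<omega> \<epsilon> N L d N' d' ls \<longleftrightarrow>
     N \<le> N' \<and> d \<le> d' \<and> length ls = L \<and> (\<forall>l\<in>set ls. is_baseconv_layer \<omega> \<epsilon> N' d' l)"

definition embed_block :: "nat \<Rightarrow> nat \<Rightarrow> real mat \<Rightarrow> real mat" where
  "embed_block N' d' u =
     mat N' d' (\<lambda>(i, j). if i < dim_row u \<and> j < dim_col u then u $$ (i, j) else 0)"

definition top_left_block :: "nat \<Rightarrow> nat \<Rightarrow> real mat \<Rightarrow> real mat" where
  "top_left_block N d A = mat N d (\<lambda>ij. A $$ ij)"

definition model_output ::
    "nat \<Rightarrow> nat \<Rightarrow> nat \<Rightarrow> nat \<Rightarrow> baseconv_layer list \<Rightarrow> real mat \<Rightarrow> real mat" where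
  "model_output N d N' d' ls u = top_left_block N d (fold apply_layer ls (embed_block N' d' u))"

text \<open>Variables and outputs of the circuit are laid out row by row in \<open>n \<times> d\<close> matrices; entries
  of the model's result beyond the last circuit output are unconstrained.\<close>

definition simulates ::
    "nat \<Rightarrow> nat \<Rightarrow> nat \<Rightarrow> nat \<Rightarrow> baseconv_layer list \<Rightarrow> arith_circuit \<Rightarrow> bool" where
  "simulates n d N' d' ls C \<longleftrightarrow>
     (\<forall>u\<in>carrier_mat n d. \<forall>k<length (outputs C).
        model_output n d N' d' ls u $$ (k div d, k mod d) =
        circuit_output C (\<lambda>i. u $$ (i div d, i mod d)) ! k)"

end

theory Submission
  imports Defs "HOL-Combinatorics.Permutations"
begin

text \<open>
  A constant matrix is a kaleidoscope matrix (each butterfly factor is made of blocks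
  \<open>[[I, I], [I, I]]\<close>), so a model can keep all its columns equal to one vector of length
  \<open>O(w)\<close>, on which a layer acts by circular shifts, masks and pointwise products. Three disjoint
  regions of the vector make room for masked copies, which gives conditional swaps of entries at
  distance \<open>2\<^sup>k\<close>. A Benes network of such swaps realises every permutation in \<open>O(log w)\<close> layers; with
  a segmented broadcast by doubling this extends to every map of positions, and a segmented sum or
  product by doubling evaluates gates of unbounded fan-in. Hence each level of the circuit costs
  \<open>O(log w)\<close> layers if the vector holds the values of the nodes that are outputs or feed a wire of
  the current cut, of which there are at most \<open>2 w\<close>.
\<close>

section \<open>Kaleidoscope matrices and circular convolution\<close>

text \<open>The difficulty is position dependence. A convolution moves all positions alike, and the
  pointwise factor of the same layer scales the finished sum of all shifted copies, so one layer
  cannot let each position choose its own source. Hence two layers per step: one parks the shifted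
  copies in separate regions, each under its own mask, the next adds or multiplies them. Gaps of
  length \<open>m\<close> between the regions keep shifts by less than \<open>m\<close> apart; this
  makes the vector \<open>6 * m\<close> cells long for \<open>m\<close> cells of data. As a layer
  always multiplies two factors, a linear step spends one of them on a constant bias. A general map
  involves up to \<open>m\<close> different distances, too many to be handled one by one; the powers
  of two are logarithmically few. The number of data cells is a power of two that is at least
  \<open>3 * w\<close>. In passing a level, the kept values take \<open>w\<close> cells and one per
  output, the wires into new gates take \<open>w\<close> more, and there are at most
  \<open>n * d \<le> w\<close> outputs. Every weight has width 1 and expansion 2, so the
  polylogarithmic bounds are met by constants.\<close>

lemma mod_less_twice:
  fixes x M :: nat
  assumes "x < 2 * M"
  shows "x mod M = (if x < M then x else x - M)"
  using assms by (auto simp: le_mod_geq)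

text \<open>\<open>X ^ M\<close> is 1 modulo \<open>X ^ M - 1\<close>, so exponents count only
  modulo \<open>M\<close>; the divisibility is the factorisation of \<open>y ^ q - 1\<close> at
  \<open>y = X ^ M\<close>.\<close>

lemma monom_mod_circular:
  fixes c :: real
  assumes "0 < M"
  shows "monom c k mod (monom 1 M - 1) = monom c (k mod M)"
proof -
  let ?m = "monom 1 M - 1 :: real poly"
  have deg: "degree ?m = M"
    using degree_add_eq_left[of "- 1 :: real poly" "monom 1 M"] assms by (simp add: degree_monom_eq)
  have m0: "?m \<noteq> 0" using deg assms by auto
  have *: "monom c k = monom c (k mod M) * (monom 1 M) ^ (k div M)"
    by (simp add: monom_power mult_monom)
  have "?m dvd monom 1 M ^ (k div M) - 1 ^ (k div M)"
    by (simp add: power_diff_1_eq)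
  then have "?m dvd monom c (k mod M) * (monom 1 M ^ (k div M) - 1)"
    by (simp add: dvd_mult)
  then have "?m dvd monom c k - monom c (k mod M)"
    by (subst *) (simp add: algebra_simps)
  then have "(monom c k - monom c (k mod M)) mod ?m = 0" by auto
  then have "monom c k mod ?m = monom c (k mod M) mod ?m" by (simp add: poly_mod_diff_left)
  also have "\<dots> = monom c (k mod M)"
  proof (rule mod_poly_less)
    have "degree (monom c (k mod M)) \<le> k mod M" by (rule degree_monom_le)
    also have "\<dots> < M" using assms by simp
    finally show "degree (monom c (k mod M)) < degree ?m" using deg by simp
  qed
  finally show ?thesis .
qed

lemma sum_poly_mod:
  fixes f :: "'a \<Rightarrow> 'b::field poly"
  shows "(\<Sum>i\<in>A. f i) mod q = (\<Sum>i\<in>A. f i mod q)"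
  by (induction A rule: infinite_finite_induct) (simp_all add: poly_mod_add_left)

text \<open>Kernel entry \<open>a\<close> moves a column down by \<open>a\<close>, so position
  \<open>i\<close> reads position \<open>i - a\<close>. Reading ahead by \<open>t\<close> therefore
  takes a 1 at the residue of \<open>- t\<close>.\<close>

lemma column_conv_indicator:
  assumes "T \<subseteq> {..<M}" and "i < M" and "j < d" and "u \<in> carrier_mat M d" and "h \<in> carrier_mat M d"
    and h: "\<And>a. a < M \<Longrightarrow> h $$ (a, j) = (if (M - a) mod M \<in> T then 1 else 0)"
  shows "column_conv Circular h u $$ (i, j) = (\<Sum>t\<in>T. u $$ ((i + t) mod M, j))"
proof -
  have M: "0 < M" using assms(2) by simp
  have du: "dim_row u = M" "dim_col u = d" "dim_row h = M" using assms by auto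
  have "(col_poly h j * col_poly u j) mod (monom 1 M - 1)
      = (\<Sum>a<M. \<Sum>b<M. monom (h $$ (a, j) * u $$ (b, j)) ((a + b) mod M))"
    unfolding col_poly_def du sum_product mult_monom
    by (simp add: sum_poly_mod monom_mod_circular[OF M])
  then have "column_conv Circular h u $$ (i, j)
      = (\<Sum>a<M. \<Sum>b<M. if (a + b) mod M = i then h $$ (a, j) * u $$ (b, j) else 0)"
    using assms(2,3) du by (simp add: column_conv_def coeff_sum)
  also have "\<dots> = (\<Sum>a<M. h $$ (a, j) * u $$ ((i + (M - a) mod M) mod M, j))"
  proof (rule sum.cong[OF refl])
    fix a assume a: "a \<in> {..<M}"
    let ?b = "(i + (M - a) mod M) mod M"
    have eq: "(a + b) mod M = i \<longleftrightarrow> b = ?b" if "b < M" for b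
    proof -
      have b': "?b = (if a \<le> i then i - a else i + M - a)"
        using a assms(2) by (cases "a = 0") (auto simp: mod_less_twice)
      show ?thesis unfolding b' using a that assms(2) by (auto simp: mod_less_twice)
    qed
    have "(\<Sum>b<M. if (a + b) mod M = i then h $$ (a, j) * u $$ (b, j) else 0)
        = (\<Sum>b<M. if b = ?b then h $$ (a, j) * u $$ (b, j) else 0)"
      by (rule sum.cong) (auto simp: eq)
    then show "(\<Sum>b<M. if (a + b) mod M = i then h $$ (a, j) * u $$ (b, j) else 0)
        = h $$ (a, j) * u $$ (?b, j)" using M by simp
  qed
  also have "\<dots> = (\<Sum>a<M. if (M - a) mod M \<in> T then u $$ ((i + (M - a) mod M) mod M, j) else 0)"
    by (rule sum.cong) (auto simp: h)
  also have "\<dots> = (\<Sum>t<M. if t \<in> T then u $$ ((i + t) mod M, j) else 0)"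
  proof (rule sum.reindex_bij_witness[where i = "\<lambda>t. (M - t) mod M" and j = "\<lambda>a. (M - a) mod M"])
  qed (use M in \<open>auto simp: mod_less_twice\<close>)
  also have "\<dots> = (\<Sum>t\<in>T. u $$ ((i + t) mod M, j))"
    using assms(1) by (simp add: sum.If_cases Int_absorb1)
  finally show ?thesis .
qed

section \<open>Constant matrices as butterfly products\<close>

definition const_mat :: "nat \<Rightarrow> real \<Rightarrow> real mat" where
  "const_mat n c = mat n n (\<lambda>_. c)"

definition fill_factor :: "nat \<Rightarrow> real \<Rightarrow> real mat" where
  "fill_factor k c = (let D = c \<cdot>\<^sub>m 1\<^sub>m (k div 2) in four_block_mat D D D D)"

lemma diag_block_mat_replicate:
  assumes F: "F \<in> carrier_mat k k"
  shows "diag_block_mat (replicate m F) = mat (m * k) (m * k)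
    (\<lambda>(x, y). if x div k = y div k then F $$ (x mod k, y mod k) else (0 :: real))"
proof (induction m)
  case 0
  show ?case by auto
next
  case (Suc m)
  have dF: "dim_row F = k" "dim_col F = k" using F by auto
  show ?case
  proof (rule eq_matI, goal_cases)
    case (1 x y)
    then have xy: "x < k + m * k" "y < k + m * k" by auto
    then have k: "k > 0" by (cases k) auto
    have *: "z div k = (if z < k then 0 else Suc ((z - k) div k))"
      "z mod k = (if z < k then z else (z - k) mod k)" for z
      using k by (auto simp: le_div_geq le_mod_geq)
    show ?case using xy k dF
      by (cases "x < k"; cases "y < k") (auto simp: Suc Let_def *[of x] *[of y])
  qed (auto simp: Suc dF Let_def)
qed

lemma fill_factor_carrier: "even k \<Longrightarrow> fill_factor k c \<in> carrier_mat k k"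
  unfolding fill_factor_def Let_def by (auto intro!: carrier_matI)

lemma butterfly_factor_fill: "even k \<Longrightarrow> butterfly_factor k (fill_factor k c)"
  unfolding butterfly_factor_def fill_factor_def Let_def diagonal_mat_def
  by (rule exI[of _ "c \<cdot>\<^sub>m 1\<^sub>m (k div 2)"])+ auto

lemma fill_factor_index:
  assumes "even k" "x < k" "y < k"
  shows "fill_factor k c $$ (x, y) = (if x mod (k div 2) = y mod (k div 2) then c else 0)"
  using assms unfolding fill_factor_def Let_def by (auto simp: mod_less_twice elim!: evenE)

definition fill_stage :: "nat \<Rightarrow> nat \<Rightarrow> real \<Rightarrow> real mat" where
  "fill_stage n k c = diag_block_mat (replicate (n div k) (fill_factor k c))"

lemma fill_stage_altdef:
  assumes "even k" "k dvd n" "0 < k"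
  shows "fill_stage n k c = mat n n (\<lambda>(x, y).
    if x div k = y div k \<and> x mod (k div 2) = y mod (k div 2) then c else 0)"
proof -
  have "x mod k mod (k div 2) = x mod (k div 2)" for x
    using assms by (auto elim!: evenE simp: mod_mod_cancel)
  then show ?thesis
    unfolding fill_stage_def diag_block_mat_replicate[OF fill_factor_carrier[OF assms(1)]]
    using assms by (intro eq_matI) (auto simp: fill_factor_index)
qed

text \<open>With \<open>c = 1\<close>, the product of the stages of factor size at most
  \<open>k\<close>: the identity for \<open>k = 1\<close>. For \<open>k = n\<close> it is the
  constant matrix.\<close>

definition block_ones :: "nat \<Rightarrow> nat \<Rightarrow> real \<Rightarrow> real mat" where
  "block_ones n k c = mat n n (\<lambda>(x, y). if x div k = y div k then c else 0)"

lemma fill_stage_mult_block_ones: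
  assumes "2 * k dvd n" "0 < k"
  shows "fill_stage n (2 * k) c * block_ones n k 1 = block_ones n (2 * k) c"
proof -
  from assms(1) obtain q where n: "n = 2 * k * q" by auto
  show ?thesis
  proof (rule eq_matI, goal_cases)
    case (1 x y)
    then have xy: "x < n" "y < n" by (auto simp: block_ones_def)
    \<comment> \<open>The only inner index that can contribute: its block is that of
      \<open>y\<close>, its residue that of \<open>x\<close>.\<close>
    define w where "w = k * (y div k) + x mod k"
    have z: "w < n"
    proof -
      have "y < (2 * q) * k" using xy by (simp add: n ac_simps)
      then have "y div k < 2 * q" by (rule less_mult_imp_div_less)
      then have "k * (y div k) + k \<le> k * (2 * q)"
        by (metis Suc_leI add.commute mult_Suc_right mult_le_mono2)
      moreover have "x mod k < k" using assms by simp
      moreover have "n = k * (2 * q)" by (simp add: n)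
      ultimately show ?thesis unfolding w_def by linarith
    qed
    have eq: "(x div (2 * k) = z div (2 * k) \<and> x mod k = z mod k) \<and> z div k = y div k
        \<longleftrightarrow> z = w \<and> x div (2 * k) = y div (2 * k)" for z
    proof -
      have d: "a div (2 * k) = a div k div 2" for a by (simp add: div_mult2_eq mult.commute)
      have "z div k = y div k \<and> x mod k = z mod k \<longleftrightarrow> z = w"
        unfolding w_def using assms(2) by (metis div_mult_mod_eq div_mult_self4 div_less mod_less_divisor mod_mult_self4
            mod_mod_trivial mult.commute add_0_right not_less_zero less_not_refl2)
      then show ?thesis unfolding d by auto
    qed
    have if_conj: "(if P then c else 0) * (if Q then 1 else 0) = (if R then (if S then c else 0) else 0)"
      if "(P \<and> Q) \<longleftrightarrow> (R \<and> S)" for P Q R S using that by auto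
    have "(fill_stage n (2 * k) c * block_ones n k 1) $$ (x, y) =
      (\<Sum>z<n. (if x div (2 * k) = z div (2 * k) \<and> x mod k = z mod k then c else 0) *
              (if z div k = y div k then 1 else 0))"
      using xy assms by (simp add: fill_stage_altdef block_ones_def scalar_prod_def atLeast0LessThan)
    also have "\<dots> = (\<Sum>z<n. if z = w then (if x div (2 * k) = y div (2 * k) then c else 0) else 0)"
      proof (rule sum.cong[OF refl])
      fix z
      show "(if x div (2 * k) = z div (2 * k) \<and> x mod k = z mod k then c else 0) *
          (if z div k = y div k then 1 else 0) =
          (if z = w then (if x div (2 * k) = y div (2 * k) then c else 0) else 0)"
        by (rule if_conj) (rule eq)
    qed
    also have "\<dots> = (if x div (2 * k) = y div (2 * k) then c else 0)" using z by simp
    finally show ?case using xy by (simp add: block_ones_def)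
  qed (auto simp: fill_stage_altdef block_ones_def assms)
qed

lemma block_ones_1: "block_ones n 1 1 = 1\<^sub>m n"
  by (rule eq_matI) (auto simp: block_ones_def)

lemma fill_stages_product:
  assumes "i \<le> r"
  shows "foldr (*) (map (\<lambda>i. fill_stage (2 ^ r) (2 ^ r div 2 ^ i) 1) [i..<r]) (1\<^sub>m (2 ^ r))
    = block_ones (2 ^ r) (2 ^ (r - i)) 1"
  using assms
proof (induction i rule: inc_induct)
  case base
  then show ?case by (simp add: block_ones_1[simplified])
next
  case (step i)
  have e: "2 ^ r div 2 ^ i = (2 :: nat) * 2 ^ (r - Suc i)"
    using step.hyps by (simp add: power_diff[symmetric] Suc_diff_Suc flip: power_Suc)
  have "2 * 2 ^ (r - Suc i) dvd (2 :: nat) ^ r"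
    using step.hyps by (metis Suc_diff_Suc diff_le_self le_imp_power_dvd power_Suc)
  then show ?case
    using step fill_stage_mult_block_ones[of "2 ^ (r - Suc i)" "2 ^ r" 1]
    by (simp add: upt_conv_Cons e Suc_diff_Suc flip: power_Suc)
qed

lemma const_mat_butterfly:
  assumes "1 \<le> r"
  shows "const_mat (2 ^ r) c \<in> butterfly (2 ^ r)"
proof -
  let ?D = "2 ^ r :: nat"
  \<comment> \<open>The scalar goes into the leftmost stage alone; the other stages then multiply to
    blocks of ones.\<close>
  define Bs where "Bs = map (\<lambda>i. fill_stage ?D (?D div 2 ^ i) (if i = 0 then c else 1)) [0..<r]"
  have k: "?D div 2 ^ i = 2 ^ (r - i)" if "i < r" for i
    using that by (simp add: power_diff)
  have k2: "even (?D div 2 ^ i)" if "i < r" for i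
    using that by (subst k) simp_all
  have "butterfly_factor_matrix ?D (?D div 2 ^ i) (Bs ! i)" if "i < r" for i
    unfolding butterfly_factor_matrix_def Bs_def fill_stage_def using that butterfly_factor_fill k2
    by (auto intro!: exI[of _ "replicate (?D div (?D div 2 ^ i))
      (fill_factor (?D div 2 ^ i) (if i = 0 then c else 1))"])
  moreover have "mat_prod_list ?D Bs = const_mat ?D c"
  proof -
    have r: "[0..<r] = 0 # [1..<r]" using assms by (simp add: upt_conv_Cons)
    have D: "?D = 2 * 2 ^ (r - 1)" using assms by (cases r) auto
    have *: "map (\<lambda>i. fill_stage ?D (?D div 2 ^ i) (if i = 0 then c else 1)) [1..<r]
      = map (\<lambda>i. fill_stage ?D (?D div 2 ^ i) 1) [1..<r]" by auto
    have "mat_prod_list ?D Bs = fill_stage ?D ?D c *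
        foldr (*) (map (\<lambda>i. fill_stage ?D (?D div 2 ^ i) 1) [1..<r]) (1\<^sub>m ?D)"
      unfolding mat_prod_list_def Bs_def r list.map * by simp
    also have "\<dots> = fill_stage ?D (2 * 2 ^ (r - 1)) c * block_ones ?D (2 ^ (r - 1)) 1"
      unfolding fill_stages_product[OF assms] using D by metis
    also have "\<dots> = block_ones ?D ?D c" using D by (subst fill_stage_mult_block_ones) auto
    also have "\<dots> = const_mat ?D c" by (rule eq_matI) (auto simp: block_ones_def const_mat_def)
    finally show ?thesis .
  qed
  ultimately show ?thesis unfolding butterfly_def
    by (auto intro!: exI[of _ Bs] exI[of _ r] simp: Bs_def)
qed

text \<open>Expansion 2 makes the inner size at least 2 even for \<open>d = 1\<close>; in size 1 the
  empty product, the identity, is the only butterfly matrix.\<close>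

lemma const_mat_kaleidoscope:
  assumes "1 \<le> d"
  shows "const_mat d c \<in> kaleidoscope d 1 2"
proof -
  define r where "r = (LEAST r. 2 * d \<le> 2 ^ r)"
  let ?D = "2 ^ r :: nat"
  have "2 * d \<le> ?D" unfolding r_def
    by (rule LeastI[of "\<lambda>r. 2 * d \<le> 2 ^ r" "2 * d"]) (simp add: less_exp less_imp_le)
  moreover then have "1 \<le> r" using assms by (cases r) auto
  ultimately have dD: "d \<le> ?D" and r: "1 \<le> r" by auto
  \<comment> \<open>With entries \<open>1 / ?D\<close> in the second factor, the \<open>?D\<close>
    equal terms of each inner product add up to \<open>c\<close>.\<close>
  have "const_mat ?D c = const_mat ?D c * transpose_mat (const_mat ?D (1 / real ?D))"
    by (rule eq_matI) (auto simp: const_mat_def scalar_prod_def)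
  then have "const_mat ?D c \<in> BBstar ?D"
    unfolding BBstar_def using const_mat_butterfly[OF r] by blast
  moreover have "mat_prod_list ?D [const_mat ?D c] = const_mat ?D c"
    by (simp add: mat_prod_list_def const_mat_def)
  ultimately have E: "const_mat ?D c \<in> BBstar_power ?D 1"
    unfolding BBstar_power_def by (auto intro!: exI[of _ "[const_mat ?D c]"])
  define S :: "real mat" where "S = mat d ?D (\<lambda>(i, j). if i = j then 1 else 0)"
  have SE: "S * const_mat ?D c = mat d ?D (\<lambda>_. c)"
    using dD by (intro eq_matI) (auto simp: S_def const_mat_def scalar_prod_def if_distrib[of "\<lambda>x. x * _"] cong: if_cong)
  have "const_mat d c = S * const_mat ?D c * transpose_mat S"
    unfolding SE using dD by (intro eq_matI) (auto simp: S_def const_mat_def scalar_prod_def if_distrib[of "\<lambda>x. _ * x"] cong: if_cong)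
  moreover have "pow2_ceil (2 * d) = ?D" by (simp add: pow2_ceil_def r_def)
  ultimately show ?thesis unfolding kaleidoscope_def using E S_def by auto
qed

section \<open>Programs of layers acting on a vector\<close>

type_synonym vlayer = "real \<times> nat set \<times> (nat \<Rightarrow> real) \<times> (nat \<Rightarrow> real)"

text \<open>The layer formula on one of the equal columns: \<open>c\<close> comes from the weight,
  the offsets \<open>T\<close> from a 0-1 kernel, \<open>b\<close> and \<open>b'\<close> from the
  biases.\<close>

definition vapply :: "nat \<Rightarrow> vlayer \<Rightarrow> (nat \<Rightarrow> real) \<Rightarrow> nat \<Rightarrow> real" where
  "vapply M = (\<lambda>(c, T, b, b') f i. if i < M
     then (c * f i + b i) * ((\<Sum>t\<in>T. f ((i + t) mod M)) + b' i) else 0)"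

text \<open>The first \<open>m\<close> cells are data, the other \<open>5 * m\<close> are scratch.
  The scratch is zero before and after a program, so programs compose by concatenation. Values of
  \<open>F f\<close> from \<open>m\<close> on do not count, and \<open>L\<close> is only an upper
  bound.\<close>

definition computes :: "nat \<Rightarrow> nat \<Rightarrow> ((nat \<Rightarrow> real) \<Rightarrow> nat \<Rightarrow> real) \<Rightarrow> bool" where
  "computes m L F \<longleftrightarrow> (\<exists>ls. length ls \<le> L \<and> (\<forall>l\<in>set ls. fst (snd l) \<subseteq> {..<6 * m}) \<and>
     (\<forall>f. (\<forall>i\<ge>m. f i = 0) \<longrightarrow> fold (vapply (6 * m)) ls f = (\<lambda>i. if i < m then F f i else 0)))"

lemma computes_mono:
  assumes "computes m L F" and "L \<le> L'"
    and "\<And>f i. (\<forall>i\<ge>m. f i = 0) \<Longrightarrow> i < m \<Longrightarrow> F f i = G f i"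
  shows "computes m L' G"
proof -
  obtain ls where "length ls \<le> L" "\<forall>l\<in>set ls. fst (snd l) \<subseteq> {..<6 * m}"
    and "\<forall>f. (\<forall>i\<ge>m. f i = 0) \<longrightarrow> fold (vapply (6 * m)) ls f = (\<lambda>i. if i < m then F f i else 0)"
    using assms(1) unfolding computes_def by auto
  moreover have "(\<lambda>i. if i < m then F f i else 0) = (\<lambda>i. if i < m then G f i else 0)"
    if "\<forall>i\<ge>m. f i = 0" for f using assms(3)[OF that] by auto
  ultimately show ?thesis unfolding computes_def using assms(2)
    by (intro exI[of _ ls]) auto
qed

lemma computes_id: "computes m 0 (\<lambda>f. f)"
  unfolding computes_def by (auto intro!: exI[of _ "[]"] simp: fun_eq_iff)

lemma computes_comp:
  assumes "computes m L F" and "computes m L' G"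
  shows "computes m (L + L') (\<lambda>f. G (\<lambda>i. if i < m then F f i else 0))"
proof -
  obtain ls where "length ls \<le> L" "\<forall>l\<in>set ls. fst (snd l) \<subseteq> {..<6 * m}"
    and "\<forall>f. (\<forall>i\<ge>m. f i = 0) \<longrightarrow> fold (vapply (6 * m)) ls f = (\<lambda>i. if i < m then F f i else 0)"
    using assms(1) unfolding computes_def by auto
  moreover obtain ls' where "length ls' \<le> L'" "\<forall>l\<in>set ls'. fst (snd l) \<subseteq> {..<6 * m}"
    and "\<forall>f. (\<forall>i\<ge>m. f i = 0) \<longrightarrow> fold (vapply (6 * m)) ls' f = (\<lambda>i. if i < m then G f i else 0)"
    using assms(2) unfolding computes_def by auto
  ultimately show ?thesis unfolding computes_def
    by (intro exI[of _ "ls @ ls'"]) auto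
qed

lemma computes_one_layer:
  assumes "T \<subseteq> {..<6 * m}"
    and "\<And>f i. (\<forall>i\<ge>m. f i = 0) \<Longrightarrow> i < 6 * m \<Longrightarrow>
      vapply (6 * m) (c, T, b, b') f i = (if i < m then F f i else 0)"
  shows "computes m 1 F"
proof -
  have "vapply (6 * m) (c, T, b, b') f = (\<lambda>i. if i < m then F f i else 0)" if "\<forall>i\<ge>m. f i = 0" for f
  proof
    fix i
    show "vapply (6 * m) (c, T, b, b') f i = (if i < m then F f i else 0)"
      using assms(2)[OF that, of i] by (cases "i < 6 * m") (auto simp: vapply_def)
  qed
  then show ?thesis
    unfolding computes_def using assms(1) by (intro exI[of _ "[(c, T, b, b')]"]) auto
qed

section \<open>Elementary operations of one or two layers\<close>

lemma computes_bias: "computes m 1 (\<lambda>f i. f i + q i)"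
  \<comment> \<open>An empty set of taps and \<open>b' = 1\<close> turn the second factor into
    1.\<close>
  by (rule computes_one_layer[where T = "{}" and c = 1 and b = "\<lambda>i. if i < m then q i else 0"
        and b' = "\<lambda>_. 1"]) (auto simp: vapply_def)

text \<open>Three disjoint regions of the vector receive masked copies of \<open>f\<close>, unshifted and shifted by
  \<open>k\<close> in either direction; a second layer recombines them.\<close>

definition spread :: "nat \<Rightarrow> nat \<Rightarrow> (nat \<Rightarrow> real) \<Rightarrow> (nat \<Rightarrow> real) \<Rightarrow> (nat \<Rightarrow> real) \<Rightarrow>
    (nat \<Rightarrow> real) \<Rightarrow> nat \<Rightarrow> real" where
  "spread m k a a' a'' f p = (if p < m then a p * f p
     else if 2 * m \<le> p \<and> p < 3 * m then a' (p - 2 * m) * f (p - 2 * m + k)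
     else if 4 * m \<le> p \<and> p < 5 * m then a'' (p - 4 * m) * f (p - 4 * m - k) else 0)"

text \<open>\<open>c = 0\<close> leaves only the masks in the first factor; they are written as the
  spread of the constant 1 without shift. Modulo \<open>6 * m\<close> the offsets
  \<open>4 * m + k\<close> and \<open>2 * m - k\<close> are \<open>k - 2 * m\<close> and
  \<open>- k - 4 * m\<close>: they fetch data for the regions that start at \<open>2 * m\<close> and
  \<open>4 * m\<close>.\<close>

definition spread_layer :: "nat \<Rightarrow> nat \<Rightarrow> (nat \<Rightarrow> real) \<Rightarrow> (nat \<Rightarrow> real) \<Rightarrow> (nat \<Rightarrow> real) \<Rightarrow> vlayer" where
  "spread_layer m k a a' a'' = (0, {0, 4 * m + k, 2 * m - k}, spread m 0 a a' a'' (\<lambda>_. 1), \<lambda>_. 0)"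

text \<open>Thanks to the gaps, only the tap meant for a region can reach data from there; the other
  two land on zeros. The assumption on \<open>a''\<close> covers \<open>i < k\<close>, where the
  truncated subtraction in \<open>spread\<close> would read cell 0.\<close>

lemma vapply_spread_layer:
  assumes "k < m" and f: "\<forall>i\<ge>m. f i = 0"
    and "\<And>i. i < m \<Longrightarrow> i + k \<ge> m \<Longrightarrow> a' i = 0" and "\<And>i. i < k \<Longrightarrow> a'' i = 0"
  shows "vapply (6 * m) (spread_layer m k a a' a'') f = spread m k a a' a'' f"
proof
  fix p
  have sum: "(\<Sum>t\<in>{0, 4 * m + k, 2 * m - k}. f ((p + t) mod (6 * m)))
      = f (p mod (6 * m)) + f ((p + (4 * m + k)) mod (6 * m)) + f ((p + (2 * m - k)) mod (6 * m))"
    using assms(1) by auto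
  consider "p < m" | "2 * m \<le> p" "p < 3 * m" | "4 * m \<le> p" "p < 5 * m"
    | "m \<le> p \<and> p < 2 * m \<or> 3 * m \<le> p \<and> p < 4 * m \<or> 5 * m \<le> p" by linarith
  then show "vapply (6 * m) (spread_layer m k a a' a'') f p = spread m k a a' a'' f p"
  proof cases
    case 1
    then show ?thesis using assms(1) f
      unfolding spread_layer_def vapply_def split_conv sum by (simp add: spread_def)
  next
    case 2
    have "(p + (4 * m + k)) mod (6 * m) = p - 2 * m + k" 
      using 2 assms(1) by (subst le_mod_geq) auto
    moreover have "(p + (2 * m - k)) mod (6 * m) = p + (2 * m - k)" using 2 assms(1) by auto
    ultimately show ?thesis using assms(1) f 2
      unfolding spread_layer_def vapply_def split_conv sum by (auto simp add: spread_def)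
  next
    case 3
    have "(p + (4 * m + k)) mod (6 * m) = p - 2 * m + k" 
      using 3 assms(1) by (subst le_mod_geq) auto
    moreover have "(p + (2 * m - k)) mod (6 * m) = p - 4 * m - k" if "k \<le> p - 4 * m"
      using 3 assms(1) that by (subst le_mod_geq) auto
    ultimately show ?thesis using assms f 3
      unfolding spread_layer_def vapply_def split_conv sum
      by (cases "k \<le> p - 4 * m") (auto simp add: spread_def)
  next
    case 4
    then show ?thesis unfolding spread_layer_def vapply_def split_conv sum 
      by (auto simp: spread_def)
  qed
qed

lemma computes_spread_then:
  assumes "k < m"
    and "\<And>i. i < m \<Longrightarrow> i + k \<ge> m \<Longrightarrow> a' i = 0" and "\<And>i. i < k \<Longrightarrow> a'' i = 0"
    and "T \<subseteq> {..<6 * m}"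
    and "\<And>f i. (\<forall>i\<ge>m. f i = 0) \<Longrightarrow> i < 6 * m \<Longrightarrow>
      vapply (6 * m) (c, T, b, b') (spread m k a a' a'' f) i = (if i < m then F f i else 0)"
  shows "computes m 2 F"
proof -
  have "vapply (6 * m) (c, T, b, b') (spread m k a a' a'' f) = (\<lambda>i. if i < m then F f i else 0)"
    if "\<forall>i\<ge>m. f i = 0" for f
  proof
    fix i
    show "vapply (6 * m) (c, T, b, b') (spread m k a a' a'' f) i = (if i < m then F f i else 0)"
      using assms(5)[OF that, of i] by (cases "i < 6 * m") (auto simp: vapply_def)
  qed
  then show ?thesis
    unfolding computes_def using assms vapply_spread_layer[OF assms(1) _ assms(2,3)]
    by (intro exI[of _ "[spread_layer m k a a' a'', (c, T, b, b')]"]) (auto simp: spread_layer_def)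
qed

lemma computes_three_taps:
  assumes "k < m"
    and "\<And>i. i < m \<Longrightarrow> i + k \<ge> m \<Longrightarrow> a' i = 0" and "\<And>i. i < k \<Longrightarrow> a'' i = 0"
  shows "computes m 2 (\<lambda>f i. a i * f i + a' i * f (i + k) + a'' i * f (i - k))"
proof (rule computes_spread_then[OF assms, where c = 0 and T = "{0, 2 * m, 4 * m}"
      and b = "\<lambda>i. if i < m then 1 else 0" and b' = "\<lambda>_. 0" and a = a])
qed (use assms(1) in \<open>auto simp: vapply_def spread_def\<close>)

text \<open>The one layer both of whose factors depend on the data: the first carries
  \<open>f i\<close>, the second \<open>f (i + k)\<close> where \<open>P\<close> holds and the bias
  1 at the other data cells.\<close>

lemma computes_masked_mult:
  assumes "k < m" and "\<And>i. i < m \<Longrightarrow> P i \<Longrightarrow> i + k < m"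
  shows "computes m 2 (\<lambda>f i. if P i then f i * f (i + k) else f i)"
proof (rule computes_spread_then[where c = 1 and T = "{2 * m}" and b = "\<lambda>_. 0"
      and b' = "\<lambda>i. if i < m \<and> \<not> P i then 1 else 0"
      and a = "\<lambda>_. 1" and a' = "\<lambda>i. if P i then 1 else 0" and a'' = "\<lambda>_. 0"])
  show "k < m" by fact
  show "(if P i then 1 else 0) = (0 :: real)" if "i < m" "i + k \<ge> m" for i
    using assms(2)[OF that(1)] that by auto
qed (use assms(1) in \<open>auto simp: vapply_def spread_def\<close>)

lemma computes_masked_add:
  assumes "k < m" and "\<And>i. i < m \<Longrightarrow> P i \<Longrightarrow> i + k < m"
  shows "computes m 2 (\<lambda>f i. if P i then f i + f (i + k) else f i)"
proof (rule computes_mono[OF computes_three_taps[of k m "\<lambda>i. if P i then 1 else 0" "\<lambda>_. 0" "\<lambda>_. 1"]])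
  show "(if P i then 1 else 0) = (0 :: real)" if "i < m" "i + k \<ge> m" for i
    using assms(2)[OF that(1)] that by auto
qed (use assms(1) in auto)

lemma computes_near_gather:
  assumes "k < m" and "\<And>i. i < m \<Longrightarrow> g i < m \<and> (g i = i \<or> g i = i + k \<or> g i + k = i)"
  shows "computes m 2 (\<lambda>f i. f (g i))"
\<comment> \<open>For \<open>k = 0\<close> the three masks used below would all be 1 and yield
  \<open>3 * f i\<close>.\<close>
proof (cases "k = 0")
  case True
  then show ?thesis using assms by (intro computes_mono[OF computes_id]) auto
next
  case False
  show ?thesis
  proof (rule computes_mono[OF computes_three_taps[of k m "\<lambda>i. if g i = i + k \<and> i < m then 1 else 0"
          "\<lambda>i. if g i + k = i then 1 else 0" "\<lambda>i. if g i = i then 1 else 0"]])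
    show "(if g i = i + k \<and> i < m then 1 else 0) = (0 :: real)" if "i < m" "i + k \<ge> m" for i
      using assms(2)[OF that(1)] that by auto
    fix f :: "nat \<Rightarrow> real" and i assume "i < m"
    then show "(if g i = i then 1 else 0) * f i + (if g i = i + k \<and> i < m then 1 else 0) * f (i + k) +
        (if g i + k = i then 1 else 0) * f (i - k) = f (g i)"
      using assms(2)[of i] False by (auto simp: eq_diff_iff intro!: arg_cong[of _ _ f])
  qed (use assms(1) in auto)
qed

lemma computes_gather_comp:
  assumes "computes m L (\<lambda>f i. f (g i))" and "computes m L' (\<lambda>f i. f (h i))"
    and "\<And>i. i < m \<Longrightarrow> h i < m"
  shows "computes m (L + L') (\<lambda>f i. f (g (h i)))"
  by (rule computes_mono[OF computes_comp[OF assms(1,2)]]) (use assms(3) in auto)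

section \<open>Routing a permutation\<close>

text \<open>The edges from \<open>x\<close> to \<open>\<sigma> x\<close> and to
  \<open>\<tau> x\<close> alternate along every path, so cycles have even length and the graph is
  bipartite. Each component consists of two orbits of \<open>\<rho>\<close>, exchanged by both
  involutions; these are the colour classes.\<close>

lemma involutions_two_colouring:
  fixes \<sigma> \<tau> :: "nat \<Rightarrow> nat"
  assumes \<sigma>: "\<And>x. \<sigma> (\<sigma> x) = x" "\<And>x. \<sigma> x \<noteq> x" and \<tau>: "\<And>x. \<tau> (\<tau> x) = x" "\<And>x. \<tau> x \<noteq> x"
  shows "\<exists>c :: nat \<Rightarrow> bool. \<forall>x. c (\<sigma> x) \<noteq> c x \<and> c (\<tau> x) \<noteq> c x"
proof -
  define \<rho> where "\<rho> = \<tau> \<circ> \<sigma>"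
  define \<rho>' where "\<rho>' = \<sigma> \<circ> \<tau>"
  have inv: "\<rho> (\<rho>' x) = x" "\<rho>' (\<rho> x) = x" for x using \<sigma>(1) \<tau>(1) by (auto simp: \<rho>_def \<rho>'_def)
  have invn: "(\<rho> ^^ n) ((\<rho>' ^^ n) x) = x" for n x
  proof (induction n arbitrary: x)
    case (Suc n)
    then show ?case by (subst funpow_Suc_right) (simp add: inv)
  qed simp
  have injn: "(\<rho> ^^ n) x = (\<rho> ^^ n) y \<longleftrightarrow> x = y" for n x y
    by (induction n) (auto, metis inv(2))
  have comm: "(\<rho> ^^ n) (\<sigma> x) = \<sigma> ((\<rho>' ^^ n) x)" for n x
    by (induction n) (auto simp: \<rho>_def \<rho>'_def \<sigma>(1))
  \<comment> \<open>Passing from \<open>n + 2\<close> to \<open>n\<close> replaces \<open>y\<close>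
    by \<open>\<rho> y\<close>; the cases 0 and 1 would give fixed points of \<open>\<sigma>\<close>
    and \<open>\<tau>\<close>.\<close>
  have never: "(\<rho> ^^ n) y \<noteq> \<sigma> y" for n y
  proof (induction n arbitrary: y rule: induct_nat_012)
    case 0
    then show ?case using \<sigma>(2)[of y] by auto
  next
    case 1
    then show ?case using \<tau>(2) by (auto simp: \<rho>_def)
  next
    case (ge2 n)
    show ?case
    proof
      assume "(\<rho> ^^ Suc (Suc n)) y = \<sigma> y"
      then have "\<rho>' (\<rho> ((\<rho> ^^ n) (\<rho> y))) = \<rho>' (\<sigma> y)" by (simp add: funpow_swap1)
      then have "(\<rho> ^^ n) (\<rho> y) = \<rho>' (\<sigma> y)" by (simp add: inv)
      also have "\<rho>' (\<sigma> y) = \<sigma> (\<rho> y)" by (simp add: \<rho>_def \<rho>'_def)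
      finally show False using ge2(1) by blast
    qed
  qed
  \<comment> \<open>The same orbit of \<open>\<rho>\<close>, stated with forward powers only since
    \<open>\<rho>\<close> is invertible.\<close>
  define R where "R x y \<longleftrightarrow> (\<exists>j k. (\<rho> ^^ j) x = (\<rho> ^^ k) y)" for x y
  have R_refl: "R x x" for x unfolding R_def by auto
  have R_sym: "R x y \<Longrightarrow> R y x" for x y unfolding R_def by metis
  have R_trans: "R x z" if "R x y" "R y z" for x y z
  proof -
    from that obtain j k j' k' where *: "(\<rho> ^^ j) x = (\<rho> ^^ k) y" "(\<rho> ^^ j') y = (\<rho> ^^ k') z"
      unfolding R_def by auto
    have "(\<rho> ^^ (j' + j)) x = (\<rho> ^^ j') ((\<rho> ^^ k) y)" by (simp add: funpow_add *(1))
    also have "\<dots> = (\<rho> ^^ (k + j')) y" by (simp add: funpow_add[symmetric, THEN fun_cong, unfolded comp_def] add.commute)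
    also have "\<dots> = (\<rho> ^^ (k + k')) z" by (simp add: funpow_add *(2))
    finally show ?thesis unfolding R_def by blast
  qed
  have not_R: "\<not> R x (\<sigma> x)" for x
  proof
    assume "R x (\<sigma> x)"
    then obtain j k where "(\<rho> ^^ j) x = (\<rho> ^^ k) (\<sigma> x)" unfolding R_def by auto
    then have "(\<rho> ^^ j) ((\<rho> ^^ k) ((\<rho>' ^^ k) x)) = \<sigma> ((\<rho>' ^^ k) x)" by (simp add: invn comm)
    then have "(\<rho> ^^ (j + k)) ((\<rho>' ^^ k) x) = \<sigma> ((\<rho>' ^^ k) x)" by (simp add: funpow_add)
    then show False using never by blast
  qed
  define rep where "rep x = (LEAST y. R x y)" for x
  have rep: "R x (rep x)" for x unfolding rep_def by (rule LeastI) (rule R_refl)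
  have rep_eq: "rep x = rep y" if "R x y" for x y
    unfolding rep_def using that R_sym R_trans by (intro arg_cong[of _ _ Least] ext) blast
  have rep_neq: "rep x \<noteq> rep (\<sigma> x)" for x using rep[of x] rep[of "\<sigma> x"] not_R[of x] R_sym R_trans by metis
  \<comment> \<open>Of the two orbits, the one with the smaller least element is coloured
    true.\<close>
  define c where "c x \<longleftrightarrow> rep x < rep (\<sigma> x)" for x
  have \<tau>\<sigma>: "rep (\<tau> x) = rep (\<sigma> x)" "rep (\<sigma> (\<tau> x)) = rep x" for x
  proof -
    have "R (\<sigma> x) (\<tau> x)"
      unfolding R_def by (rule exI[of _ 1], rule exI[of _ 0]) (simp add: \<rho>_def \<sigma>(1))
    then show "rep (\<tau> x) = rep (\<sigma> x)" using rep_eq by metis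
    have "R (\<sigma> (\<tau> x)) x"
      unfolding R_def by (rule exI[of _ 1], rule exI[of _ 0]) (simp add: \<rho>_def \<sigma>(1) \<tau>(1))
    then show "rep (\<sigma> (\<tau> x)) = rep x" using rep_eq by metis
  qed
  have "c (\<sigma> x) \<noteq> c x \<and> c (\<tau> x) \<noteq> c x" for x
    using rep_neq[of x] unfolding c_def by (auto simp: \<sigma>(1) \<tau>\<sigma>)
  then show ?thesis by blast
qed

text \<open>Toggles binary digit \<open>r\<close>, which is the parity of
  \<open>i div 2 ^ r\<close>.\<close>

definition flip :: "nat \<Rightarrow> nat \<Rightarrow> nat" where
  "flip r i = (if even (i div 2 ^ r) then i + 2 ^ r else i - 2 ^ r)"

lemma odd_div_le: "odd (i div 2 ^ r) \<Longrightarrow> 2 ^ r \<le> (i :: nat)"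
  by (rule ccontr) auto

text \<open>\<open>2 ^ Suc r\<close> divides \<open>2 ^ R\<close>, so a map that keeps the blocks of
  size \<open>2 ^ Suc r\<close> also keeps the range below \<open>2 ^ R\<close>.\<close>

lemma less_power_iff_div:
  fixes i :: nat
  assumes "r < R"
  shows "i < 2 ^ R \<longleftrightarrow> i div 2 ^ Suc r < 2 ^ (R - Suc r)"
proof -
  have "(2 :: nat) ^ (R - Suc r) * 2 ^ Suc r = 2 ^ R"
    using assms by (simp only: power_add[symmetric]) simp
  then show ?thesis by (simp only: div_less_iff_less_mult[of "2 ^ Suc r"] zero_less_power zero_less_numeral)
qed

lemma flip_neq: "flip r i \<noteq> i"
proof -
  have "(0 :: nat) < 2 ^ r" by simp
  then have "i - 2 ^ r \<noteq> i" if "odd (i div 2 ^ r)" using odd_div_le[OF that] by linarith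
  then show ?thesis unfolding flip_def by simp
qed

lemma div_flip: "flip r i div 2 ^ r = (if even (i div 2 ^ r) then i div 2 ^ r + 1 else i div 2 ^ r - 1)"
proof (cases "2 ^ r \<le> i")
  case True
  then show ?thesis by (auto simp: flip_def le_div_geq)
qed (auto simp: flip_def)

lemma flip_flip: "flip r (flip r i) = i"
  using div_flip[of r i] odd_div_le[of i r] unfolding flip_def by (auto split: if_splits)

lemma even_flip: "even (flip r i div 2 ^ r) \<longleftrightarrow> odd (i div 2 ^ r)"
  unfolding div_flip by (auto elim!: oddE)

lemma div_flip_Suc: "flip r i div 2 ^ Suc r = i div 2 ^ Suc r"
  unfolding power_Suc2 div_mult2_eq div_flip by (auto elim!: oddE evenE)

text \<open>One level of the Benes recursion: \<open>\<gamma>\<close> and \<open>\<delta>\<close>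
  are the outer columns of switches, and the remaining \<open>\<beta>\<close> stays within half
  blocks. A two-colouring decides through which half each value travels: partners at one end must
  take different halves, and so must values that are partners at the other end.\<close>

lemma benes_routing:
  assumes "r < R" and "\<pi> permutes {..<2 ^ R}" and "\<And>i. \<pi> i div 2 ^ Suc r = i div 2 ^ Suc r"
  shows "\<exists>\<gamma> \<delta> \<beta>. \<beta> permutes {..<2 ^ R} \<and> (\<forall>i. \<beta> i div 2 ^ r = i div 2 ^ r) \<and>
    (\<forall>i. \<gamma> i = i \<or> \<gamma> i = flip r i) \<and> (\<forall>i. \<delta> i = i \<or> \<delta> i = flip r i) \<and> (\<forall>i. \<pi> i = \<delta> (\<beta> (\<gamma> i)))"
proof -
  have bij: "bij \<pi>" using assms(2) by (rule permutes_bij)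
  have inv1: "inv_into UNIV \<pi> (\<pi> i) = i" "\<pi> (inv_into UNIV \<pi> i) = i" for i
    using permutes_inverses[OF assms(2)] by auto
  \<comment> \<open>\<open>\<tau> i\<close> is the position whose image is the partner of the image
    of \<open>i\<close>.\<close>
  define \<tau> where "\<tau> i = inv_into UNIV \<pi> (flip r (\<pi> i))" for i
  have "\<exists>c :: nat \<Rightarrow> bool. \<forall>x. c (flip r x) \<noteq> c x \<and> c (\<tau> x) \<noteq> c x"
  proof (rule involutions_two_colouring)
    show "\<tau> (\<tau> x) = x" for x by (simp only: \<tau>_def inv1 flip_flip)
    show "\<tau> x \<noteq> x" for x unfolding \<tau>_def using inv1(2) flip_neq by metis
  qed (rule flip_flip flip_neq)+
  then obtain c :: "nat \<Rightarrow> bool" where c: "\<And>x. c (flip r x) \<noteq> c x" "\<And>x. c (\<tau> x) \<noteq> c x" by blast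
  define E where "E i \<longleftrightarrow> even (i div 2 ^ r)" for i :: nat
  define D where "D i = i div 2 ^ Suc r" for i :: nat
  have E_flip: "E (flip r i) \<longleftrightarrow> \<not> E i" for i by (simp only: E_def even_flip)
  have D_flip: "D (flip r i) = D i" for i unfolding D_def by (rule div_flip_Suc)
  \<comment> \<open>The member of the pair of \<open>i\<close> that lies in the lower half
    (\<open>b\<close> true) or the upper half. As partners have different colours,
    \<open>\<gamma>\<close> maps them to different members.\<close>
  define place where "place b i = (if E i = b then i else flip r i)" for b i
  have place: "E (place b i) = b" "D (place b i) = D i" "place b i = i \<or> place b i = flip r i" for b i
    unfolding place_def by (auto simp: E_flip D_flip)
  define \<gamma> where "\<gamma> i = place (c i) i" for i
  define \<delta> where "\<delta> i = place (c (inv_into UNIV \<pi> i)) i" for i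
  have \<gamma>_flip: "\<gamma> (flip r i) = flip r (\<gamma> i)" for i
    using c(1)[of i] by (auto simp: \<gamma>_def place_def E_flip flip_flip)
  have \<delta>_flip: "\<delta> (flip r i) = flip r (\<delta> i)" for i
    using c(2)[of "inv_into UNIV \<pi> i"] by (auto simp: \<delta>_def place_def E_flip flip_flip \<tau>_def inv1)
  have \<gamma>\<gamma>: "\<gamma> (\<gamma> i) = i" for i
    using place(3)[of "c i" i] \<gamma>_flip flip_flip unfolding \<gamma>_def[symmetric] by metis
  have \<delta>\<delta>: "\<delta> (\<delta> i) = i" for i
    using place(3)[of "c (inv_into UNIV \<pi> i)" i] \<delta>_flip flip_flip unfolding \<delta>_def[symmetric] by metis
  define \<beta> where "\<beta> i = \<delta> (\<pi> (\<gamma> i))" for i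
  have D_\<pi>: "D (\<pi> i) = D i" for i using assms(3) unfolding D_def .
  have D_\<beta>: "D (\<beta> i) = D i" for i
    unfolding \<beta>_def \<delta>_def \<gamma>_def place(2) D_\<pi> ..
  \<comment> \<open>Both \<open>i\<close> and \<open>\<beta> i\<close> lie in the half named by the
    colour of \<open>\<gamma> i\<close>.\<close>
  have E_\<beta>: "E (\<beta> i) = E i" for i
  proof -
    have "E (\<gamma> (\<gamma> i)) = c (\<gamma> i)" unfolding \<gamma>_def[of "\<gamma> i"] by (rule place(1))
    then show ?thesis unfolding \<gamma>\<gamma> \<beta>_def \<delta>_def place(1) inv1 by (rule sym)
  qed
  have half: "a = b" if "a div 2 = b div 2" "even a = even b" for a b :: nat
    using that by presburger
  have block: "\<beta> i div 2 ^ r = i div 2 ^ r" for i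
    using D_\<beta>[of i] E_\<beta>[of i] unfolding D_def E_def power_Suc2 div_mult2_eq by (rule half)
  have "bij \<beta>"
  proof -
    have "bij \<gamma>" "bij \<delta>" using \<gamma>\<gamma> \<delta>\<delta> by (auto intro: involuntory_imp_bij)
    then show ?thesis using bij_comp[OF bij_comp[OF _ bij], of \<gamma> \<delta>]
      by (simp add: \<beta>_def[abs_def] comp_def)
  qed
  have bound: "i < 2 ^ R \<longleftrightarrow> j < 2 ^ R" if "D i = D j" for i j :: nat
    using that unfolding D_def less_power_iff_div[OF assms(1)] by simp
  have \<gamma>_bound: "\<gamma> i < 2 ^ R \<longleftrightarrow> i < 2 ^ R" for i unfolding \<gamma>_def by (rule bound) (rule place)
  have \<beta>_bound: "\<beta> i < 2 ^ R \<longleftrightarrow> i < 2 ^ R" for i by (rule bound) (rule D_\<beta>)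
  have fixed: "\<pi> i = i" "inv_into UNIV \<pi> i = i" if "\<not> i < 2 ^ R" for i
    using assms(2) permutes_inv[OF assms(2)] that by (auto simp: permutes_def)
  have "\<beta> permutes {..<2 ^ R}"
  proof (rule bij_imp_permutes)
    have "inj \<beta>" using \<open>bij \<beta>\<close> by (simp add: bij_is_inj)
    then have "inj_on \<beta> {..<2 ^ R}" by (rule inj_on_subset) simp
    moreover have "\<beta> ` {..<2 ^ R} \<subseteq> {..<2 ^ R}" using \<beta>_bound by auto
    ultimately show "bij_betw \<beta> {..<2 ^ R} {..<2 ^ R}"
      unfolding bij_betw_def by (simp add: endo_inj_surj)
    fix i assume "i \<notin> {..<(2 :: nat) ^ R}"
    then have "\<not> \<gamma> i < 2 ^ R" using \<gamma>_bound by simp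
    then have "\<beta> i = \<gamma> (\<gamma> i)" unfolding \<beta>_def \<delta>_def by (simp add: fixed \<gamma>_def[of "\<gamma> i"])
    then show "\<beta> i = i" by (simp only: \<gamma>\<gamma>)
  qed
  moreover have "\<gamma> i = i \<or> \<gamma> i = flip r i" "\<delta> i = i \<or> \<delta> i = flip r i" for i
    unfolding \<gamma>_def \<delta>_def by (rule place(3))+
  moreover have "\<pi> i = \<delta> (\<beta> (\<gamma> i))" for i
    unfolding \<beta>_def \<gamma>\<gamma> \<delta>\<delta> ..
  ultimately show ?thesis using block by blast
qed

lemma flip_less:
  assumes "r < R" "i < 2 ^ R"
  shows "flip r i < 2 ^ R"
  using assms(2) unfolding less_power_iff_div[OF assms(1)] div_flip_Suc .

lemma computes_flip_gather:
  assumes "r < R" and "\<And>i. \<gamma> i = i \<or> \<gamma> i = flip r i"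
  shows "computes (2 ^ R) 2 (\<lambda>f i. f (\<gamma> i))"
proof (rule computes_near_gather)
  show "2 ^ r < (2 :: nat) ^ R" using assms(1) by simp
  show "\<gamma> i < 2 ^ R \<and> (\<gamma> i = i \<or> \<gamma> i = i + 2 ^ r \<or> \<gamma> i + 2 ^ r = i)" if "i < 2 ^ R" for i
  proof -
    have "flip r i = i + 2 ^ r \<or> flip r i + 2 ^ r = i"
      unfolding flip_def using odd_div_le[of i r] by simp
    then show ?thesis using assms(2)[of i] flip_less[OF assms(1) that] that by metis
  qed
qed

text \<open>All blocks are routed at once; each level of the recursion adds two columns of switches,
  of two layers each.\<close>

lemma computes_block_permutation:
  assumes "r \<le> R" and "\<pi> permutes {..<2 ^ R}" and "\<And>i. \<pi> i div 2 ^ r = i div 2 ^ r"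
  shows "computes (2 ^ R) (4 * r) (\<lambda>f i. f (\<pi> i))"
  using assms
proof (induction r arbitrary: \<pi>)
  case 0
  then show ?case using computes_mono[OF computes_id] by auto
next
  case (Suc r)
  then obtain \<gamma> \<delta> \<beta> where \<beta>: "\<beta> permutes {..<2 ^ R}" "\<And>i. \<beta> i div 2 ^ r = i div 2 ^ r"
    and \<gamma>: "\<And>i. \<gamma> i = i \<or> \<gamma> i = flip r i" and \<delta>: "\<And>i. \<delta> i = i \<or> \<delta> i = flip r i"
    and \<pi>: "\<And>i. \<pi> i = \<delta> (\<beta> (\<gamma> i))"
    using benes_routing[of r R \<pi>] by (metis Suc_le_lessD)
  have r: "r < R" using Suc.prems by simp
  have "computes (2 ^ R) (2 + 4 * r) (\<lambda>f i. f (\<delta> (\<beta> i)))"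
  proof (rule computes_gather_comp[where g = \<delta> and h = \<beta>])
    show "computes (2 ^ R) 2 (\<lambda>f i. f (\<delta> i))" by (rule computes_flip_gather[OF r \<delta>])
    show "computes (2 ^ R) (4 * r) (\<lambda>f i. f (\<beta> i))" using Suc.IH[OF _ \<beta>] r by simp
    show "\<beta> i < 2 ^ R" if "i < 2 ^ R" for i using permutes_in_image[OF \<beta>(1), of i] that by simp
  qed
  then have "computes (2 ^ R) (2 + 4 * r + 2) (\<lambda>f i. f (\<delta> (\<beta> (\<gamma> i))))"
  proof (rule computes_gather_comp[where g = "\<lambda>i. \<delta> (\<beta> i)" and h = \<gamma>])
    show "\<gamma> i < 2 ^ R" if "i < 2 ^ R" for i using \<gamma>[of i] flip_less[OF r that] that by metis
    show "computes (2 ^ R) 2 (\<lambda>f i. f (\<gamma> i))" by (rule computes_flip_gather[OF r \<gamma>])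
  qed
  then show ?case unfolding \<pi> by (rule computes_mono) simp_all
qed

lemma computes_permutation:
  assumes "\<pi> permutes {..<2 ^ R}"
  shows "computes (2 ^ R) (4 * R) (\<lambda>f i. f (\<pi> i))"
proof (rule computes_block_permutation[OF order_refl assms])
  show "\<pi> i div 2 ^ R = i div 2 ^ R" for i
    using assms permutes_in_image[OF assms, of i] by (cases "i < 2 ^ R") (auto simp: permutes_def)
qed

section \<open>Gathering and segmented reduction\<close>

lemma inj_extends_to_permutation:
  assumes "finite A" and "S \<subseteq> A" and "inj_on g S" and "g ` S \<subseteq> A"
  shows "\<exists>\<pi>. \<pi> permutes A \<and> (\<forall>x\<in>S. \<pi> x = g x)"
proof -
  have "card (A - S) = card (A - g ` S)"
    using assms by (simp add: card_Diff_subset finite_subset card_image)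
  then obtain h where h: "bij_betw h (A - S) (A - g ` S)"
    using assms(1) by (metis finite_Diff finite_same_card_bij)
  define \<pi> where "\<pi> x = (if x \<in> S then g x else if x \<in> A then h x else x)" for x
  have "bij_betw \<pi> S (g ` S)"
    using assms(3) by (auto simp: bij_betw_def \<pi>_def inj_on_def image_def)
  moreover have "bij_betw \<pi> (A - S) (A - g ` S) \<longleftrightarrow> bij_betw h (A - S) (A - g ` S)"
    by (rule bij_betw_cong) (simp add: \<pi>_def)
  ultimately have "bij_betw \<pi> (S \<union> (A - S)) (g ` S \<union> (A - g ` S))"
    using h by (intro bij_betw_combine) auto
  then have "bij_betw \<pi> A A" using assms(2,4) by (simp add: Un_absorb1)
  then have "\<pi> permutes A" by (rule bij_imp_permutes) (use assms(2) in \<open>auto simp: \<pi>_def\<close>)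
  then show ?thesis by (auto simp: \<pi>_def)
qed

text \<open>\<open>s j\<close> is the left end of the segment of \<open>j\<close>. After
  \<open>t\<close> rounds the cells at distance less than \<open>2 ^ t\<close> from it hold its
  value, the others still their own.\<close>

lemma computes_broadcast:
  assumes s_le: "\<And>j. j < 2 ^ R \<Longrightarrow> s j \<le> j"
    and s_eq: "\<And>i j. j < 2 ^ R \<Longrightarrow> s j \<le> i \<Longrightarrow> i \<le> j \<Longrightarrow> s i = s j"
  shows "computes (2 ^ R) (2 * R) (\<lambda>f j. f (s j))"
proof -
  have "computes (2 ^ R) (2 * t) (\<lambda>f j. f (if j - s j < 2 ^ t then s j else j))" if "t \<le> R" for t
    using that
  proof (induction t)
    case 0
    have "f j = f (if j - s j < 2 ^ 0 then s j else j)" if "j < 2 ^ R" for f :: "nat \<Rightarrow> real" and j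
      using s_le[OF that] by (intro arg_cong[of _ _ f]) simp
    then show ?case by (intro computes_mono[OF computes_id]) simp_all
  next
    case (Suc t)
    \<comment> \<open>Only cells at distance from \<open>2 ^ t\<close> to below
      \<open>2 ^ Suc t\<close> copy in this round; their source lies in the same segment and was
      served before.\<close>
    define h where "h j = (if 2 ^ t \<le> j - s j \<and> j - s j < 2 ^ Suc t then j - 2 ^ t else j)" for j
    have h: "h j = j \<or> h j + 2 ^ t = j" for j unfolding h_def by auto
    have "computes (2 ^ R) (2 * t + 2) (\<lambda>f j. f (if h j - s (h j) < 2 ^ t then s (h j) else h j))"
    proof (rule computes_gather_comp[where g = "\<lambda>j. if j - s j < 2 ^ t then s j else j" and h = h])
      show "computes (2 ^ R) 2 (\<lambda>f j. f (h j))"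
      proof (rule computes_near_gather)
        show "2 ^ t < (2 :: nat) ^ R" using Suc.prems by simp
        show "h i < 2 ^ R \<and> (h i = i \<or> h i = i + 2 ^ t \<or> h i + 2 ^ t = i)" if "i < 2 ^ R" for i
          using h[of i] that by linarith
      qed
      show "h i < 2 ^ R" if "i < 2 ^ R" for i using h[of i] that by linarith
    qed (use Suc in simp)
    then show ?case
    proof (rule computes_mono)
      fix f :: "nat \<Rightarrow> real" and j :: nat assume j: "j < 2 ^ R"
      have "(if h j - s (h j) < 2 ^ t then s (h j) else h j) = (if j - s j < 2 ^ Suc t then s j else j)"
      proof (cases "2 ^ t \<le> j - s j \<and> j - s j < 2 ^ Suc t")
        case True
        then have "h j = j - 2 ^ t" by (simp add: h_def)
        moreover have "s (j - 2 ^ t) = s j" by (rule s_eq[OF j]) (use True s_le[OF j] in auto)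
        moreover have "j - 2 ^ t - s j < 2 ^ t" using True by (simp del: diff_diff_left) linarith
        ultimately show ?thesis using True by simp
      next
        case False
        then have "h j = j" unfolding h_def by (rule if_not_P)
        then show ?thesis using False by auto
      qed
      then show "f (if h j - s (h j) < 2 ^ t then s (h j) else h j)
          = f (if j - s j < 2 ^ Suc t then s j else j)" by (rule arg_cong)
    qed simp
  qed
  from this[OF order_refl] show ?thesis
  proof (rule computes_mono)
    show "f (if i - s i < 2 ^ R then s i else i) = f (s i)" if "i < 2 ^ R" for f :: "nat \<Rightarrow> real" and i
      using that by auto
  qed simp
qed

text \<open>Sorting the positions by source makes equal sources contiguous. One permutation brings
  each value to the head of its run, a broadcast fills the run, another permutation undoes the
  sorting: \<open>4 * R + 2 * R + 4 * R\<close> layers.\<close>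

lemma computes_gather:
  assumes \<phi>: "\<And>i. i < 2 ^ R \<Longrightarrow> \<phi> i < 2 ^ R"
  shows "computes (2 ^ R) (10 * R) (\<lambda>f i. f (\<phi> i))"
proof -
  let ?m = "2 ^ R :: nat"
  define js where "js = sort_key \<phi> [0..<?m]"
  have js: "length js = ?m" "set js = {..<?m}" "distinct js" "sorted (map \<phi> js)"
    unfolding js_def by (simp_all add: atLeast0LessThan)
  define \<rho> where "\<rho> j = (if j < ?m then js ! j else j)" for j
  have \<rho>: "\<rho> permutes {..<?m}"
  proof (rule bij_imp_permutes)
    have "bij_betw ((!) js) {..<?m} {..<?m}"
      by (rule bij_betw_nth) (simp_all add: js)
    moreover have "bij_betw \<rho> {..<?m} {..<?m} \<longleftrightarrow> bij_betw ((!) js) {..<?m} {..<?m}"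
      by (rule bij_betw_cong) (simp add: \<rho>_def)
    ultimately show "bij_betw \<rho> {..<?m} {..<?m}" by blast
  qed (auto simp: \<rho>_def)
  have \<rho>_less: "\<rho> i < ?m" if "i < ?m" for i using permutes_in_image[OF \<rho>, of i] that by simp
  have mono: "\<phi> (\<rho> i) \<le> \<phi> (\<rho> j)" if "i \<le> j" "j < ?m" for i j
    using sorted_nth_mono[OF js(4) that(1)] that js(1) by (simp add: \<rho>_def)
  define s where "s j = (LEAST i. \<phi> (\<rho> i) = \<phi> (\<rho> j))" for j
  have s: "\<phi> (\<rho> (s j)) = \<phi> (\<rho> j)" "s j \<le> j" for j
    unfolding s_def by (rule LeastI[of _ j], simp) (rule Least_le, simp)
  have s_cong: "s i = s j" if "\<phi> (\<rho> i) = \<phi> (\<rho> j)" for i j unfolding s_def that ..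
  define S where "S = {j. j < ?m \<and> s j = j}"
  \<comment> \<open>Run heads have distinct sources, so this partial map extends to a permutation;
    whatever the other cells receive is overwritten by the broadcast.\<close>
  have "\<exists>\<sigma>. \<sigma> permutes {..<?m} \<and> (\<forall>x\<in>S. \<sigma> x = (\<phi> \<circ> \<rho>) x)"
  proof (rule inj_extends_to_permutation)
    show "inj_on (\<phi> \<circ> \<rho>) S"
    proof (rule inj_onI)
      fix x y assume "x \<in> S" "y \<in> S" "(\<phi> \<circ> \<rho>) x = (\<phi> \<circ> \<rho>) y"
      then show "x = y" using s_cong[of x y] by (simp add: S_def)
    qed
    show "(\<phi> \<circ> \<rho>) ` S \<subseteq> {..<?m}" using \<phi> \<rho>_less by (auto simp: S_def)
  qed (auto simp: S_def)
  then obtain \<sigma> where \<sigma>: "\<sigma> permutes {..<?m}" "\<And>x. x \<in> S \<Longrightarrow> \<sigma> x = \<phi> (\<rho> x)" by auto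
  have \<rho>': "inv_into UNIV \<rho> permutes {..<?m}" using \<rho> by (rule permutes_inv)
  have \<rho>'_less: "inv_into UNIV \<rho> i < ?m" if "i < ?m" for i using permutes_in_image[OF \<rho>', of i] that by simp
  have s_S: "s j \<in> S" if "j < ?m" for j
    using s(2)[of j] that s_cong[OF s(1)] by (simp add: S_def)
  have "computes ?m (4 * R + 2 * R) (\<lambda>f i. f (\<sigma> (s i)))"
  proof (rule computes_gather_comp[where g = \<sigma> and h = s])
    show "computes ?m (4 * R) (\<lambda>f i. f (\<sigma> i))" by (rule computes_permutation[OF \<sigma>(1)])
    show "computes ?m (2 * R) (\<lambda>f i. f (s i))"
    proof (rule computes_broadcast[OF s(2)])
      fix i j assume "j < ?m" "s j \<le> i" "i \<le> j"
      then have "\<phi> (\<rho> i) = \<phi> (\<rho> j)"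
        using mono[of i j] mono[of "s j" i] s(1)[of j] by simp
      then show "s i = s j" by (rule s_cong)
    qed
    show "s i < ?m" if "i < ?m" for i using s(2)[of i] that by simp
  qed
  then have "computes ?m (4 * R + 2 * R + 4 * R) (\<lambda>f i. f (\<sigma> (s (inv_into UNIV \<rho> i))))"
    by (rule computes_gather_comp[where g = "\<lambda>i. \<sigma> (s i)" and h = "inv_into UNIV \<rho>"])
      (auto intro: computes_permutation[OF \<rho>'] \<rho>'_less)
  then show ?thesis
  proof (rule computes_mono)
    fix f :: "nat \<Rightarrow> real" and i assume "i < ?m"
    then have "\<sigma> (s (inv_into UNIV \<rho> i)) = \<phi> (\<rho> (inv_into UNIV \<rho> i))" using \<sigma>(2)[OF s_S[OF \<rho>'_less]] s(1) by simp
    also have "\<rho> (inv_into UNIV \<rho> i) = i" using permutes_inverses(1)[OF \<rho>] by simp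
    finally show "f (\<sigma> (s (inv_into UNIV \<rho> i))) = f (\<phi> i)" by simp
  qed simp
qed

text \<open>After \<open>t\<close> rounds cell \<open>i\<close> holds the reduction of the window of
  length \<open>2 ^ t\<close> from \<open>i\<close> on, cut off at the end of its segment. A round
  is an addition pass and a multiplication pass of two layers each; the masks keep each pass off
  segments of the other kind.\<close>

lemma computes_segmented_reduce:
  assumes e: "\<And>i. i < 2 ^ R \<Longrightarrow> i < e i \<and> e i \<le> 2 ^ R"
    and seg: "\<And>i j. i < 2 ^ R \<Longrightarrow> i \<le> j \<Longrightarrow> j < e i \<Longrightarrow> e j = e i \<and> b j = b i"
  shows "computes (2 ^ R) (4 * R) (\<lambda>f i. if b i then sum f {i..<e i} else prod f {i..<e i})"
proof -
  let ?m = "2 ^ R :: nat"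
  define F where "F t f i = (let J = {i..<min (i + 2 ^ t) (e i)} in if b i then sum f J else prod f J)"
    for t and f :: "nat \<Rightarrow> real" and i
  have "computes ?m (4 * t) (F t)" if "t \<le> R" for t
    using that
  proof (induction t)
    case 0
    have "F 0 f i = f i" if "i < ?m" for f i
    proof -
      have "{i..<min (i + 2 ^ 0) (e i)} = {i}" using e[OF that] by auto
      then show ?thesis unfolding F_def Let_def by (simp only: sum.insert prod.insert) simp
    qed
    then show ?case by (intro computes_mono[OF computes_id]) simp_all
  next
    case (Suc t)
    let ?k = "2 ^ t :: nat"
    \<comment> \<open>The window of length \<open>?k\<close> from \<open>i\<close> has not yet
      reached the end of the segment.\<close>
    define P where "P i \<longleftrightarrow> i < ?m \<and> i + ?k < e i" for i
    have k: "?k < ?m" using Suc.prems by simp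
    have less: "i + ?k < ?m" if "P i" for i using that e[of i] unfolding P_def by linarith
    have F_Suc: "F (Suc t) f i = (if P i then if b i then F t f i + F t f (i + ?k)
        else F t f i * F t f (i + ?k) else F t f i)" if "i < ?m" for f i
    proof (cases "P i")
      case True
      then have ei: "e (i + ?k) = e i" "b (i + ?k) = b i" using seg[OF that, of "i + ?k"] unfolding P_def by auto
      have eq: "min (i + ?k) (e i) = i + ?k" "i + ?k + ?k = i + 2 ^ Suc t"
        using True unfolding P_def by auto
      have le: "i \<le> i + ?k" "i + ?k \<le> min (i + 2 ^ Suc t) (e i)" using True unfolding P_def by auto
      show ?thesis unfolding F_def Let_def ei eq
        using True sum.atLeastLessThan_concat[OF le, of f] prod.atLeastLessThan_concat[OF le, of f] by simp
    next
      case False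
      then have "min (i + ?k) (e i) = e i" "min (i + 2 ^ Suc t) (e i) = e i" using that unfolding P_def by auto
      then show ?thesis using False unfolding F_def by simp
    qed
    have IH: "computes ?m (4 * t) (F t)" using Suc by simp
    have add: "computes ?m 2 (\<lambda>f i. if P i \<and> b i then f i + f (i + ?k) else f i)"
      using less by (intro computes_masked_add[OF k]) auto
    have mult: "computes ?m 2 (\<lambda>f i. if P i \<and> \<not> b i then f i * f (i + ?k) else f i)"
      using less by (intro computes_masked_mult[OF k]) auto
    show ?case
    proof (rule computes_mono[OF computes_comp[OF computes_comp[OF IH add] mult]])
      fix f :: "nat \<Rightarrow> real" and i assume i: "i < ?m"
      define g where "g i = (if i < ?m then F t f i else 0)" for i
      define g' where "g' i = (if i < ?m then if P i \<and> b i then g i + g (i + ?k) else g i else 0)" for i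
      have "(if P i \<and> \<not> b i then g' i * g' (i + ?k) else g' i) = F (Suc t) f i"
      proof (cases "P i")
        case True
        \<comment> \<open>Both cells belong to one segment, so in a product segment the addition
          pass has changed neither factor.\<close>
        then have "b (i + ?k) = b i" using seg[OF i, of "i + ?k"] unfolding P_def by auto
        then show ?thesis using i less[OF True] True by (auto simp: F_Suc g'_def g_def)
      qed (use i in \<open>auto simp: F_Suc g'_def g_def\<close>)
      then show "(if P i \<and> \<not> b i
          then (if i < ?m then if P i \<and> b i then (if i < ?m then F t f i else 0) +
              (if i + ?k < ?m then F t f (i + ?k) else 0) else if i < ?m then F t f i else 0 else 0) *
            (if i + ?k < ?m then if P (i + ?k) \<and> b (i + ?k) then (if i + ?k < ?m then F t f (i + ?k) else 0) +
              (if i + ?k + ?k < ?m then F t f (i + ?k + ?k) else 0) else if i + ?k < ?m then F t f (i + ?k) else 0 else 0)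
          else if i < ?m then if P i \<and> b i then (if i < ?m then F t f i else 0) +
              (if i + ?k < ?m then F t f (i + ?k) else 0) else if i < ?m then F t f i else 0 else 0)
          = F (Suc t) f i"
        unfolding g'_def g_def .
    qed simp
  qed
  from this[OF order_refl] show ?thesis
  proof (rule computes_mono)
    fix f i assume "i < ?m"
    then have "min (i + 2 ^ R) (e i) = e i" using e[of i] by simp
    then show "F R f i = (if b i then sum f {i..<e i} else prod f {i..<e i})" unfolding F_def by simp
  qed simp
qed

text \<open>The argument lists are laid end to end: slot \<open>p\<close> reads cell
  \<open>\<phi> p\<close>, \<open>e p\<close> is the end of its segment, \<open>b p\<close> the
  operation there, and \<open>st v\<close> the first slot of gate \<open>v\<close>.\<close>

lemma segment_layout:
  assumes "finite K" and "\<And>v. v \<in> K \<Longrightarrow> args v \<noteq> []"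
  shows "\<exists>\<phi> e b st. (\<forall>p < (\<Sum>v\<in>K. length (args v)). p < e p \<and> e p \<le> (\<Sum>v\<in>K. length (args v)) \<and>
      (\<forall>q. p \<le> q \<and> q < e p \<longrightarrow> e q = e p \<and> b q = b p)) \<and>
    (\<forall>v\<in>K. st v < (\<Sum>v\<in>K. length (args v)) \<and> b (st v) = op v \<and> map \<phi> [st v..<e (st v)] = args v)"
  using assms
proof (induction K rule: finite_induct)
  case empty
  show ?case by simp
next
  case (insert w K)
  define n where "n = (\<Sum>v\<in>K. length (args v))"
  define l where "l = length (args w)"
  have l: "0 < l" using insert.prems by (simp add: l_def)
  from insert.IH insert.prems obtain \<phi> e b st
    where seg_all: "\<forall>p<n. p < e p \<and> e p \<le> n \<and> (\<forall>q. p \<le> q \<and> q < e p \<longrightarrow> e q = e p \<and> b q = b p)"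
      and st_all: "\<forall>v\<in>K. st v < n \<and> b (st v) = op v \<and> map \<phi> [st v..<e (st v)] = args v"
    unfolding n_def by blast
  have seg: "p < e p \<and> e p \<le> n \<and> (\<forall>q. p \<le> q \<and> q < e p \<longrightarrow> e q = e p \<and> b q = b p)" if "p < n" for p
    using that seg_all by blast
  have st: "st v < n \<and> b (st v) = op v \<and> map \<phi> [st v..<e (st v)] = args v" if "v \<in> K" for v
    using that st_all by blast
  define \<phi>' where "\<phi>' p = (if p < n then \<phi> p else args w ! (p - n))" for p
  define e' where "e' p = (if p < n then e p else n + l)" for p
  define b' where "b' p = (if p < n then b p else op w)" for p
  define st' where "st' v = (if v = w then n else st v)" for v
  have sum: "(\<Sum>v\<in>insert w K. length (args v)) = n + l"
    using insert.hyps by (simp add: n_def l_def)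
  have A: "p < e' p \<and> e' p \<le> n + l \<and> (\<forall>q. p \<le> q \<and> q < e' p \<longrightarrow> e' q = e' p \<and> b' q = b' p)"
    if "p < n + l" for p
  proof (cases "p < n")
    case True
    then have e': "e' p = e p" and b': "b' p = b p" by (simp_all add: e'_def b'_def)
    have p: "p < e p" "e p \<le> n" using seg[OF True] by blast+
    have eq: "e' q = e p \<and> b' q = b p" if "p \<le> q" "q < e p" for q
    proof -
      have "e' q = e q" "b' q = b q" using that p by (simp_all add: e'_def b'_def)
      then show ?thesis using seg[OF True] that by metis
    qed
    show ?thesis
    proof (intro conjI allI impI)
      show "p < e' p" "e' p \<le> n + l" using p by (simp_all add: e')
      fix q assume "p \<le> q \<and> q < e' p"
      then have "p \<le> q" "q < e p" by (simp_all add: e')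
      from eq[OF this] show "e' q = e' p" "b' q = b' p" unfolding e' b' by blast+
    qed
  next
    case False
    then show ?thesis using that by (simp add: e'_def b'_def)
  qed
  have B: "st' v < n + l \<and> b' (st' v) = op v \<and> map \<phi>' [st' v..<e' (st' v)] = args v"
    if "v \<in> insert w K" for v
  proof (cases "v = w")
    case True
    have "map \<phi>' [n..<n + l] = args w"
      by (rule nth_equalityI) (auto simp: l_def \<phi>'_def)
    then show ?thesis using True l by (simp add: st'_def e'_def b'_def)
  next
    case False
    then have v: "v \<in> K" using that by simp
    have "map \<phi>' [st v..<e (st v)] = map \<phi> [st v..<e (st v)]"
    proof (rule map_cong[OF refl])
      fix j assume "j \<in> set [st v..<e (st v)]"
      moreover have "e (st v) \<le> n" using seg[of "st v"] st[OF v] by blast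
      ultimately show "\<phi>' j = \<phi> j" by (simp add: \<phi>'_def)
    qed
    moreover have "st' v = st v" "e' (st v) = e (st v)" "b' (st v) = b (st v)"
      using st[OF v] False by (simp_all add: st'_def e'_def b'_def)
    ultimately show ?thesis using st[OF v] by simp
  qed
  show ?case unfolding sum
    by (rule exI[of _ \<phi>'], rule exI[of _ e'], rule exI[of _ b'], rule exI[of _ st'], rule conjI)
      (rule allI, rule impI, rule A, assumption, rule ballI, rule B)
qed

lemma computes_parallel_gates:
  assumes "finite K" and "\<And>v. v \<in> K \<Longrightarrow> args v \<noteq> []"
    and args: "\<And>v p. v \<in> K \<Longrightarrow> p \<in> set (args v) \<Longrightarrow> p < 2 ^ R"
    and total: "(\<Sum>v\<in>K. length (args v)) \<le> 2 ^ R"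
  shows "\<exists>F st. computes (2 ^ R) (14 * R) F \<and> (\<forall>v\<in>K. st v < 2 ^ R \<and>
    (\<forall>f. F f (st v) = (if op v then sum_list (map f (args v)) else prod_list (map f (args v)))))"
proof -
  define n where "n = (\<Sum>v\<in>K. length (args v))"
  obtain \<phi> e b st
    where seg_all: "\<forall>p<n. p < e p \<and> e p \<le> n \<and> (\<forall>q. p \<le> q \<and> q < e p \<longrightarrow> e q = e p \<and> b q = b p)"
      and st_all: "\<forall>v\<in>K. st v < n \<and> b (st v) = op v \<and> map \<phi> [st v..<e (st v)] = args v"
    using segment_layout[of K args op, OF assms(1) assms(2)] unfolding n_def by blast
  have seg: "p < e p \<and> e p \<le> n \<and> (\<forall>q. p \<le> q \<and> q < e p \<longrightarrow> e q = e p \<and> b q = b p)" if "p < n" for p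
    using that seg_all by blast
  have st: "st v < n \<and> b (st v) = op v \<and> map \<phi> [st v..<e (st v)] = args v" if "v \<in> K" for v
    using that st_all by blast
  \<comment> \<open>Gathering and reducing constrain every cell, so a source out of range becomes 0
    and slots from \<open>n\<close> on become segments of length 1.\<close>
  define \<phi>' where "\<phi>' p = (if \<phi> p < 2 ^ R then \<phi> p else 0)" for p
  define e' where "e' p = (if p < n then e p else Suc p)" for p
  have "computes (2 ^ R) (10 * R) (\<lambda>f i. f (\<phi>' i))"
    by (rule computes_gather) (simp add: \<phi>'_def)
  moreover have "computes (2 ^ R) (4 * R) (\<lambda>f i. if b i then sum f {i..<e' i} else prod f {i..<e' i})"
  proof (rule computes_segmented_reduce)
    show "i < e' i \<and> e' i \<le> 2 ^ R" if "i < 2 ^ R" for i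
    proof (cases "i < n")
      case True
      then have "e' i = e i" by (simp add: e'_def)
      moreover have "i < e i" "e i \<le> n" using seg[OF True] by blast+
      ultimately show ?thesis using total unfolding n_def by linarith
    qed (use that in \<open>simp add: e'_def\<close>)
    show "e' j = e' i \<and> b j = b i" if "i < 2 ^ R" "i \<le> j" "j < e' i" for i j
    proof (cases "i < n")
      case True
      then have "j < e i" using that by (simp add: e'_def)
      moreover have "e i \<le> n" using seg[OF True] by blast
      ultimately have "e' j = e j" "e' i = e i" using True by (simp_all add: e'_def)
      then show ?thesis using seg[OF True] that(2) \<open>j < e i\<close> by metis
    next
      case False
      then have "j = i" using that by (simp add: e'_def)
      then show ?thesis by simp
    qed
  qed
  ultimately have C: "computes (2 ^ R) (14 * R) (\<lambda>f i. if b i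
      then \<Sum>j\<in>{i..<e' i}. if j < 2 ^ R then f (\<phi>' j) else 0
      else \<Prod>j\<in>{i..<e' i}. if j < 2 ^ R then f (\<phi>' j) else 0)"
    by (rule computes_mono[OF computes_comp]) simp_all
  have D: "st v < 2 ^ R \<and> (\<forall>f :: nat \<Rightarrow> real. (if b (st v)
      then \<Sum>j\<in>{st v..<e' (st v)}. if j < 2 ^ R then f (\<phi>' j) else 0
      else \<Prod>j\<in>{st v..<e' (st v)}. if j < 2 ^ R then f (\<phi>' j) else 0)
      = (if op v then sum_list (map f (args v)) else prod_list (map f (args v))))" if v: "v \<in> K" for v
  proof (intro conjI allI)
    have st: "st v < n" "b (st v) = op v" "map \<phi> [st v..<e (st v)] = args v" using st[OF v] by blast+
    have n: "n \<le> 2 ^ R" using total by (simp add: n_def)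
    then show "st v < 2 ^ R" using st by simp
    fix f :: "nat \<Rightarrow> real"
    have e': "e' (st v) = e (st v)" using st(1) by (simp add: e'_def)
    have e_le: "e (st v) \<le> n" using seg[OF st(1)] by blast
    have set_args: "\<phi> j \<in> set (args v)" if "j \<in> {st v..<e (st v)}" for j
    proof -
      have "\<phi> j \<in> set (map \<phi> [st v..<e (st v)])" using that by simp
      then show ?thesis unfolding st(3) .
    qed
    have *: "(if j < 2 ^ R then f (\<phi>' j) else 0) = f (\<phi> j)" if "j \<in> {st v..<e (st v)}" for j
    proof -
      have "j < 2 ^ R" using that e_le n by simp
      then show ?thesis using args[OF v set_args[OF that]] by (simp add: \<phi>'_def)
    qed
    have "(\<Sum>j\<in>{st v..<e (st v)}. f (\<phi> j)) = sum_list (map f (map \<phi> [st v..<e (st v)]))"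
      using sum.distinct_set_conv_list[of "[st v..<e (st v)]" "\<lambda>j. f (\<phi> j)"] by (simp add: comp_def)
    moreover have "(\<Prod>j\<in>{st v..<e (st v)}. f (\<phi> j)) = prod_list (map f (map \<phi> [st v..<e (st v)]))"
      using prod.distinct_set_conv_list[of "[st v..<e (st v)]" "\<lambda>j. f (\<phi> j)"] by (simp add: comp_def)
    moreover have "(\<Sum>j\<in>{st v..<e (st v)}. if j < 2 ^ R then f (\<phi>' j) else 0) = (\<Sum>j\<in>{st v..<e (st v)}. f (\<phi> j))"
      "(\<Prod>j\<in>{st v..<e (st v)}. if j < 2 ^ R then f (\<phi>' j) else 0) = (\<Prod>j\<in>{st v..<e (st v)}. f (\<phi> j))"
      by (rule sum.cong[OF refl *] prod.cong[OF refl *], assumption)+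
    ultimately show "(if b (st v)
      then \<Sum>j\<in>{st v..<e' (st v)}. if j < 2 ^ R then f (\<phi>' j) else 0
      else \<Prod>j\<in>{st v..<e' (st v)}. if j < 2 ^ R then f (\<phi>' j) else 0)
      = (if op v then sum_list (map f (args v)) else prod_list (map f (args v)))"
      unfolding e' st(2,3) by simp
  qed
  show ?thesis by (rule exI, rule exI, rule conjI, rule C, rule ballI, rule D)
qed

section \<open>Levels and values of a circuit\<close>

locale circuit =
  fixes C :: arith_circuit and m :: nat
  assumes circuit_in_vars: "circuit_in_vars m C"
begin

sublocale fin_digraph "graph C"
  using circuit_in_vars by (simp add: circuit_in_vars_def)

lemma input_iff: "v \<in> verts (graph C) \<Longrightarrow> is_input C v \<longleftrightarrow> in_arcs (graph C) v = {}"
  using circuit_in_vars by (auto simp: circuit_in_vars_def)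

text \<open>A repeated node would give a cycle, so every walk is a path. The bound makes the sets of
  walk lengths finite, as \<open>Max\<close> requires.\<close>

lemma length_awalk_less:
  assumes "awalk u p v"
  shows "length p < card (verts (graph C))"
proof -
  have "distinct (awalk_verts u p)"
  proof (rule ccontr)
    assume "\<not> distinct (awalk_verts u p)"
    from awalk_not_distinct_decomp[OF assms this] obtain r w where "0 < length r" "awalk w r w" by blast
    then have "closed_w r" unfolding closed_w_def by blast
    then show False
      using closed_w_imp_cycle circuit_in_vars unfolding circuit_in_vars_def by blast
  qed
  with assms have "apath u p v" by (simp add: apath_def)
  then show ?thesis by (rule length_apath_less)
qed

definition walk_lengths :: "nat \<Rightarrow> nat set" where
  "walk_lengths v = {length p | u p. is_input C u \<and> awalk u p v}"

lemma node_level_eq: "node_level C v = Max (walk_lengths v)"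
  unfolding node_level_def walk_lengths_def ..

lemma finite_walk_lengths: "finite (walk_lengths v)"
  by (rule finite_subset[of _ "{..<card (verts (graph C))}"])
    (auto simp: walk_lengths_def dest: length_awalk_less)

text \<open>A longest walk into \<open>v\<close> starts at an input; otherwise an incoming arc would
  extend it.\<close>

lemma walk_lengths_nonempty:
  assumes "v \<in> verts (graph C)"
  shows "walk_lengths v \<noteq> {}"
proof -
  define S where "S = {length p | u p. awalk u p v}"
  have "finite S" by (rule finite_subset[of _ "{..<card (verts (graph C))}"])
      (auto simp: S_def dest: length_awalk_less)
  moreover have "length ([] :: nat list) \<in> S"
  proof -
    have "awalk v [] v" using assms by (simp add: awalk_Nil_iff)
    then show ?thesis unfolding S_def by blast
  qed
  ultimately have "Max S \<in> S" by (intro Max_in) auto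
  then obtain u p where p: "awalk u p v" "length p = Max S" unfolding S_def by auto
  have "is_input C u"
  proof (rule ccontr)
    assume "\<not> is_input C u"
    then obtain a where "a \<in> in_arcs (graph C) u"
      using input_iff[OF awalk_hd_in_verts[OF p(1)]] by blast
    then have a: "a \<in> arcs (graph C)" "head (graph C) a = u" by simp_all
    then have "awalk (tail (graph C) a) (a # p) v" using p(1) by (simp add: awalk_Cons_iff)
    then have "length (a # p) \<in> S" unfolding S_def by blast
    then have "length (a # p) \<le> Max S" using \<open>finite S\<close> by simp
    then show False using p(2) by simp
  qed
  then show ?thesis using p(1) unfolding walk_lengths_def by blast
qed

lemma node_level_walk:
  assumes "v \<in> verts (graph C)"
  obtains u p where "is_input C u" "awalk u p v" "length p = node_level C v"
proof -
  have "node_level C v \<in> walk_lengths v"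
    unfolding node_level_eq using finite_walk_lengths walk_lengths_nonempty[OF assms] by (rule Max_in)
  then show ?thesis using that unfolding walk_lengths_def by auto
qed

lemma length_walk_le_level: "is_input C u \<Longrightarrow> awalk u p v \<Longrightarrow> length p \<le> node_level C v"
  unfolding node_level_eq by (rule Max_ge[OF finite_walk_lengths]) (auto simp: walk_lengths_def)

lemma node_level_arc:
  assumes "a \<in> arcs (graph C)"
  shows "node_level C (tail (graph C) a) < node_level C (head (graph C) a)"
proof -
  obtain u p where p: "is_input C u" "awalk u p (tail (graph C) a)"
    "length p = node_level C (tail (graph C) a)"
    by (rule node_level_walk[of "tail (graph C) a"]) (use assms in auto)
  have "awalk u (p @ [a]) (head (graph C) a)"
    using p(2) arc_implies_awalk[OF assms] by (rule awalk_appendI)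
  from length_walk_le_level[OF p(1) this] show ?thesis using p(3) by simp
qed

lemma node_level_pos:
  assumes "v \<in> verts (graph C)" and "\<not> is_input C v"
  shows "0 < node_level C v"
proof -
  obtain a where "a \<in> in_arcs (graph C) v"
    using input_iff[OF assms(1)] assms(2) by blast
  then have "a \<in> arcs (graph C)" "head (graph C) a = v" by simp_all
  with node_level_arc[of a] show ?thesis by simp
qed

lemma node_level_output:
  assumes "v \<in> set (outputs C)"
  shows "node_level C v \<le> circuit_depth C"
proof -
  have "v \<in> verts (graph C)" using assms circuit_in_vars by (auto simp: circuit_in_vars_def)
  then obtain u p where p: "is_input C u" "awalk u p v" "length p = node_level C v"
    by (rule node_level_walk)
  have "finite {length p | u p v. is_input C u \<and> v \<in> set (outputs C) \<and> awalk u p v}"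
    by (rule finite_subset[of _ "{..<card (verts (graph C))}"]) (auto dest: length_awalk_less)
  then have "length p \<le> circuit_depth C"
    unfolding circuit_depth_def by (rule Max_ge) (use p(1,2) assms in blast)
  then show ?thesis by (simp add: p(3))
qed

lemma finite_cut_wires: "finite (cut_wires C t)"
  by (rule finite_subset[OF _ finite_arcs]) (auto simp: cut_wires_def)

lemma finite_cut_sizes: "finite (range (\<lambda>t. card (cut_wires C t)))"
proof (rule finite_subset)
  show "range (\<lambda>t. card (cut_wires C t)) \<subseteq> {..card (arcs (graph C))}"
    by (auto intro!: card_mono simp: cut_wires_def)
qed simp

lemma card_cut_wires_le: "card (cut_wires C t) \<le> circuit_width m' C"
  unfolding circuit_width_def using finite_cut_sizes by (intro Max_ge) auto

lemma inputs_le_width: "m' \<le> circuit_width m' C"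
  unfolding circuit_width_def using finite_cut_sizes by (intro Max_ge) auto

text \<open>Outputs are definite descriptions, so existence and uniqueness are both needed. Levels
  increase along arcs and serve as induction measure.\<close>

lemma node_value_unique_exists:
  assumes "v \<in> verts (graph C)"
  shows "\<exists>!r. node_value C x v r"
  using assms
proof (induction "node_level C v" arbitrary: v rule: less_induct)
  case less
  have IH: "\<exists>!r. node_value C x (tail (graph C) a) r" if "a \<in> in_arcs (graph C) v" for a
    by (rule less.hyps) (use node_level_arc[of a] that in auto)
  define f where "f a = (THE r. node_value C x (tail (graph C) a) r)" for a
  have f: "node_value C x (tail (graph C) a) (f a)" if "a \<in> in_arcs (graph C) v" for a
    unfolding f_def by (rule theI') (rule IH[OF that])
  have f_unique: "g a = f a" if "a \<in> in_arcs (graph C) v" "node_value C x (tail (graph C) a) (g a)" for a g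
    using IH[OF that(1)] f[OF that(1)] that(2) by blast
  show ?case
  proof (cases "label C v")
    case (Var i)
    show ?thesis
    proof (rule ex1I)
      show "node_value C x v (x i)" using less.prems Var by (rule node_value.var)
      show "r = x i" if "node_value C x v r" for r using that by cases (simp_all add: Var)
    qed
  next
    case (Const c)
    show ?thesis
    proof (rule ex1I)
      show "node_value C x v c" using less.prems Const by (rule node_value.const)
      show "r = c" if "node_value C x v r" for r using that by cases (simp_all add: Const)
    qed
  next
    case Add
    show ?thesis
    proof (rule ex1I)
      show "node_value C x v (\<Sum>a\<in>in_arcs (graph C) v. f a)"
        using f by (intro node_value.add[OF less.prems Add]) blast
      show "r = (\<Sum>a\<in>in_arcs (graph C) v. f a)" if "node_value C x v r" for r
        using that
      proof cases
        case (add g)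
        have "(\<Sum>a\<in>in_arcs (graph C) v. g a) = (\<Sum>a\<in>in_arcs (graph C) v. f a)"
          using add by (intro sum.cong refl f_unique) blast+
        then show ?thesis using add(1) by (rule trans[rotated])
      qed (simp_all add: Add)
    qed
  next
    case Mult
    show ?thesis
    proof (rule ex1I)
      show "node_value C x v (\<Prod>a\<in>in_arcs (graph C) v. f a)"
        using f by (intro node_value.mult[OF less.prems Mult]) blast
      show "r = (\<Prod>a\<in>in_arcs (graph C) v. f a)" if "node_value C x v r" for r
        using that
      proof cases
        case (mult g)
        have "(\<Prod>a\<in>in_arcs (graph C) v. g a) = (\<Prod>a\<in>in_arcs (graph C) v. f a)"
          using mult by (intro prod.cong refl f_unique) blast+
        then show ?thesis using mult(1) by (rule trans[rotated])
      qed (simp_all add: Mult)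
    qed
  qed
qed

definition val :: "(nat \<Rightarrow> real) \<Rightarrow> nat \<Rightarrow> real" where
  "val x v = (THE r. node_value C x v r)"

lemma node_value_val: "v \<in> verts (graph C) \<Longrightarrow> node_value C x v (val x v)"
  unfolding val_def by (rule theI') (rule node_value_unique_exists)

lemma val_eqI: "v \<in> verts (graph C) \<Longrightarrow> node_value C x v r \<Longrightarrow> val x v = r"
  using node_value_val node_value_unique_exists by blast

lemma val_Var: "v \<in> verts (graph C) \<Longrightarrow> label C v = Var i \<Longrightarrow> val x v = x i"
  by (intro val_eqI node_value.var)

lemma val_Const: "v \<in> verts (graph C) \<Longrightarrow> label C v = Const c \<Longrightarrow> val x v = c"
  by (intro val_eqI node_value.const)

lemma val_Add:
  assumes "v \<in> verts (graph C)" "label C v = Add"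
  shows "val x v = (\<Sum>a\<in>in_arcs (graph C) v. val x (tail (graph C) a))"
  using assms by (intro val_eqI node_value.add) (auto intro!: node_value_val)

lemma val_Mult:
  assumes "v \<in> verts (graph C)" "label C v = Mult"
  shows "val x v = (\<Prod>a\<in>in_arcs (graph C) v. val x (tail (graph C) a))"
  using assms by (intro val_eqI node_value.mult) (auto intro!: node_value_val)

lemma circuit_output_nth: "k < length (outputs C) \<Longrightarrow> circuit_output C x ! k = val x (outputs C ! k)"
  by (simp add: circuit_output_def val_def)

text \<open>An output stays live from its own level onwards, because all outputs are read off
  together at the end.\<close>

definition live :: "nat \<Rightarrow> nat set" where
  "live t = {v \<in> verts (graph C). node_level C v \<le> t \<and>
     (v \<in> set (outputs C) \<or> (\<exists>a\<in>arcs (graph C). tail (graph C) a = v \<and> t < node_level C (head (graph C) a)))}"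

lemma finite_live: "finite (live t)"
  by (rule finite_subset[OF _ finite_verts]) (auto simp: live_def)

lemma card_live_le: "card (live t) \<le> circuit_width m' C + length (outputs C)"
proof -
  have "live t \<subseteq> tail (graph C) ` cut_wires C t \<union> set (outputs C)"
    by (auto simp: live_def cut_wires_def)
  then have "card (live t) \<le> card (tail (graph C) ` cut_wires C t \<union> set (outputs C))"
    by (intro card_mono) (auto intro: finite_cut_wires)
  also have "\<dots> \<le> card (tail (graph C) ` cut_wires C t) + card (set (outputs C))" by (rule card_Un_le)
  also have "\<dots> \<le> card (cut_wires C t) + length (outputs C)"
    by (intro add_mono card_image_le card_length finite_cut_wires)
  also have "\<dots> \<le> circuit_width m' C + length (outputs C)" using card_cut_wires_le by simp
  finally show ?thesis .
qed

end

section \<open>Simulating a circuit level by level\<close>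

context circuit
begin

lemma live_0:
  assumes "v \<in> live 0"
  obtains i where "label C v = Var i" "i < m" | c where "label C v = Const c"
proof -
  have v: "v \<in> verts (graph C)" "node_level C v = 0" using assms by (auto simp: live_def)
  then have "is_input C v" using node_level_pos by fastforce
  moreover have "i < m" if "label C v = Var i" for i
    using that v(1) circuit_in_vars unfolding circuit_in_vars_def by blast
  ultimately show ?thesis using that unfolding is_input_def by blast
qed

lemma live_outputs:
  assumes "circuit_depth C \<le> t"
  shows "set (outputs C) \<subseteq> live t"
proof
  fix v assume v: "v \<in> set (outputs C)"
  then have "v \<in> verts (graph C)" using circuit_in_vars unfolding circuit_in_vars_def by blast
  then show "v \<in> live t" using v node_level_output[OF v] assms unfolding live_def by simp
qed

lemma live_SucD: "v \<in> live (Suc t) \<Longrightarrow> node_level C v \<le> t \<Longrightarrow> v \<in> live t"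
  unfolding live_def using Suc_lessD by blast

text \<open>Such a node has level exactly \<open>Suc t\<close>, so all its incoming wires cross cut
  \<open>t\<close>. Thus its arguments are at hand, and the width bounds the total fan-in of the
  level.\<close>

lemma live_Suc_tail:
  assumes "v \<in> live (Suc t)" "t < node_level C v" "a \<in> in_arcs (graph C) v"
  shows "tail (graph C) a \<in> live t" and "a \<in> cut_wires C t"
proof -
  have a: "a \<in> arcs (graph C)" "head (graph C) a = v" using assms(3) by simp_all
  have "node_level C v = Suc t" using assms(1,2) by (simp add: live_def)
  then have l: "node_level C (tail (graph C) a) \<le> t" "t < node_level C (head (graph C) a)"
    using node_level_arc[OF a(1)] a(2) by simp_all
  then show "a \<in> cut_wires C t" using a(1) by (simp add: cut_wires_def)
  have "tail (graph C) a \<in> verts (graph C)" using a(1) by (rule tail_in_verts)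
  then show "tail (graph C) a \<in> live t" using a(1) l unfolding live_def by blast
qed

text \<open>\<open>enc i\<close> is the position at which the vector holds the \<open>i\<close>-th circuit variable.\<close>

definition tracks :: "nat \<Rightarrow> (nat \<Rightarrow> nat) \<Rightarrow> nat \<Rightarrow> nat set \<Rightarrow> (nat \<Rightarrow> nat) \<Rightarrow> bool" where
  "tracks R enc L A pos \<longleftrightarrow> (\<exists>F. computes (2 ^ R) L F \<and> (\<forall>v\<in>A. pos v < 2 ^ R \<and>
     (\<forall>f x. (\<forall>i\<ge>m. f i = 0) \<longrightarrow> (\<forall>i<m. f (enc i) = x i) \<longrightarrow> F f (pos v) = val x v)))"

lemma tracksI:
  assumes "computes (2 ^ R) L F" and "\<And>v. v \<in> A \<Longrightarrow> pos v < 2 ^ R"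
    and "\<And>v f x. v \<in> A \<Longrightarrow> \<forall>i\<ge>m. f i = 0 \<Longrightarrow> \<forall>i<m. f (enc i) = x i \<Longrightarrow> F f (pos v) = val x v"
  shows "tracks R enc L A pos"
  unfolding tracks_def using assms by (intro exI[of _ F]) simp

lemma tracksE:
  assumes "tracks R enc L A pos"
  obtains F where "computes (2 ^ R) L F" and "\<And>v. v \<in> A \<Longrightarrow> pos v < 2 ^ R"
    and "\<And>v f x. v \<in> A \<Longrightarrow> \<forall>i\<ge>m. f i = 0 \<Longrightarrow> \<forall>i<m. f (enc i) = x i \<Longrightarrow> F f (pos v) = val x v"
proof -
  obtain F where F: "computes (2 ^ R) L F" and *: "\<forall>v\<in>A. pos v < 2 ^ R \<and>
     (\<forall>f x. (\<forall>i\<ge>m. f i = 0) \<longrightarrow> (\<forall>i<m. f (enc i) = x i) \<longrightarrow> F f (pos v) = val x v)"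
    using assms unfolding tracks_def by (elim exE conjE)
  show ?thesis
  proof (rule that[OF F])
    show "pos v < 2 ^ R" if "v \<in> A" for v using *[rule_format, OF that] by (rule conjunct1)
    show "F f (pos v) = val x v" if "v \<in> A" "\<forall>i\<ge>m. f i = 0" "\<forall>i<m. f (enc i) = x i" for v f x
      using bspec[OF * that(1), THEN conjunct2] that(2,3) by blast
  qed
qed

text \<open>The variables are already in place. A bias, the one layer spent here, adds the constants
  to cells from \<open>m\<close> on, which hold 0 until then.\<close>

lemma tracks_inputs:
  assumes enc: "\<And>i. i < m \<Longrightarrow> enc i < m" and R: "m + card (live 0) \<le> 2 ^ R"
  shows "\<exists>pos. tracks R enc 1 (live 0) pos"
proof -
  obtain g where g: "bij_betw g (live 0) {0..<card (live 0)}"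
    using ex_bij_betw_finite_nat[OF finite_live] by blast
  have g_less: "g v < card (live 0)" if "v \<in> live 0" for v
    using bij_betwE[OF g] that by auto
  have inv_g: "inv_into (live 0) g (g v) = v" if "v \<in> live 0" for v
    using bij_betw_inv_into_left[OF g that] .
  define pos where "pos v = (case label C v of Var i \<Rightarrow> enc i | _ \<Rightarrow> m + g v)" for v
  define q where "q p = (if p < m then 0 else
    case label C (inv_into (live 0) g (p - m)) of Const c \<Rightarrow> c | _ \<Rightarrow> 0)" for p
  have "pos v < 2 ^ R \<and> (\<forall>f x. (\<forall>i\<ge>m. f i = 0) \<longrightarrow> (\<forall>i<m. f (enc i) = x i) \<longrightarrow>
      f (pos v) + q (pos v) = val x v)" if v: "v \<in> live 0" for v
    using v
  proof (cases rule: live_0)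
    case (1 i)
    have "v \<in> verts (graph C)" using v by (simp add: live_def)
    then have val: "val x v = x i" for x using 1(1) by (rule val_Var)
    have p: "pos v = enc i" using 1(1) by (simp add: pos_def)
    then show ?thesis using enc[OF 1(2)] 1(2) R by (simp add: q_def val)
  next
    case (2 c)
    have "v \<in> verts (graph C)" using v by (simp add: live_def)
    then have val: "val x v = c" for x using 2 by (rule val_Const)
    have p: "pos v = m + g v" using 2 by (simp add: pos_def)
    then show ?thesis using g_less[OF v] R 2 by (simp add: q_def val inv_g[OF v])
  qed
  then show ?thesis unfolding tracks_def using computes_bias[of "2 ^ R" q] by blast
qed

lemma tracks_Suc:
  assumes "tracks R enc L (live t) pos" and R: "2 * circuit_width m' C + length (outputs C) \<le> 2 ^ R"
    and mR: "m \<le> 2 ^ R"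
  shows "\<exists>pos'. tracks R enc (L + 14 * R) (live (Suc t)) pos'"
proof -
  obtain F where F: "computes (2 ^ R) L F" and pos: "\<And>v. v \<in> live t \<Longrightarrow> pos v < 2 ^ R"
    and val: "\<And>v f x. v \<in> live t \<Longrightarrow> \<forall>i\<ge>m. f i = 0 \<Longrightarrow> \<forall>i<m. f (enc i) = x i \<Longrightarrow> F f (pos v) = val x v"
    using assms(1) by (rule tracksE) (rule that)
  define arcs_of where "arcs_of v = sorted_list_of_set (in_arcs (graph C) v)" for v
  have fin: "finite (in_arcs (graph C) v)" for v by (rule finite_in_arcs)
  have arcs_of: "set (arcs_of v) = in_arcs (graph C) v" "distinct (arcs_of v)"
    "length (arcs_of v) = card (in_arcs (graph C) v)" for v
    unfolding arcs_of_def using fin by simp_all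
  define old where "old = {v \<in> live (Suc t). node_level C v \<le> t}"
  define new where "new = {v \<in> live (Suc t). t < node_level C v}"
  have split: "live (Suc t) = old \<union> new" "old \<inter> new = {}" "finite old" "finite new"
    using finite_live[of "Suc t"] by (auto simp: old_def new_def)
  \<comment> \<open>A value that is merely kept counts as a gate with itself as only argument: a sum
    or product of one term is that term. So a single run of parallel gates both moves and
    computes.\<close>
  define args where "args v = (if node_level C v \<le> t then [pos v]
    else map (\<lambda>a. pos (tail (graph C) a)) (arcs_of v))" for v
  have new_gate: "in_arcs (graph C) v \<noteq> {}" "\<not> is_input C v" "v \<in> verts (graph C)" if "v \<in> new" for v
  proof -
    show v: "v \<in> verts (graph C)" using that by (simp add: new_def live_def)
    obtain u p where p: "is_input C u" "awalk u p v" "length p = node_level C v"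
      by (rule node_level_walk[OF v])
    then have "p \<noteq> []" using that by (auto simp: new_def)
    then obtain p' a where "p = p' @ [a]" by (cases p rule: rev_cases) auto
    then have "awalk (awlast u p') [a] v" using p(2) by auto
    then have "a \<in> in_arcs (graph C) v" by (auto simp: awalk_Cons_iff awalk_Nil_iff)
    then show "in_arcs (graph C) v \<noteq> {}" by blast
    then show "\<not> is_input C v" using input_iff[OF v] by blast
  qed
  have "\<exists>F st. computes (2 ^ R) (14 * R) F \<and> (\<forall>v\<in>live (Suc t). st v < 2 ^ R \<and>
    (\<forall>f. F f (st v) = (if label C v = Add then sum_list (map f (args v)) else prod_list (map f (args v)))))"
  proof (rule computes_parallel_gates)
    show "finite (live (Suc t))" by (rule finite_live)
    show "args v \<noteq> []" if "v \<in> live (Suc t)" for v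
    proof (cases "v \<in> new")
      case True
      then have "set (arcs_of v) \<noteq> {}" unfolding arcs_of(1) by (rule new_gate(1))
      then show ?thesis by (auto simp: args_def)
    next
      case False
      then show ?thesis using that by (simp add: args_def new_def)
    qed
    show "p < 2 ^ R" if v: "v \<in> live (Suc t)" and p: "p \<in> set (args v)" for v p
    proof (cases "node_level C v \<le> t")
      case True
      then show ?thesis using pos[OF live_SucD[OF v True]] p by (simp add: args_def)
    next
      case False
      then obtain a where a: "a \<in> in_arcs (graph C) v" "p = pos (tail (graph C) a)"
        using p arcs_of(1) by (auto simp: args_def)
      then show ?thesis using pos[OF live_Suc_tail(1)[OF v _ a(1)]] False by simp
    qed
    \<comment> \<open>One slot per kept value, at most the width plus the number of outputs, and one
      per wire into a new gate, at most the width.\<close>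
    have "(\<Sum>v\<in>live (Suc t). length (args v)) = (\<Sum>v\<in>old. length (args v)) + (\<Sum>v\<in>new. length (args v))"
      unfolding split(1) by (rule sum.union_disjoint) (use split(2-4) in auto)
    also have "(\<Sum>v\<in>old. length (args v)) = card old" by (simp add: args_def old_def)
    also have "card old \<le> card (live t)"
      by (rule card_mono[OF finite_live]) (auto simp: old_def intro: live_SucD)
    also have "(\<Sum>v\<in>new. length (args v)) = (\<Sum>v\<in>new. card (in_arcs (graph C) v))"
      by (rule sum.cong) (auto simp: args_def new_def arcs_of(3))
    also have "\<dots> = card (\<Union>v\<in>new. in_arcs (graph C) v)"
      by (rule card_UN_disjoint[symmetric]) (use split(4) fin in auto)
    also have "\<dots> \<le> card (cut_wires C t)"
    proof (rule card_mono[OF finite_cut_wires], rule UN_least)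
      show "in_arcs (graph C) v \<subseteq> cut_wires C t" if "v \<in> new" for v
        using live_Suc_tail(2)[of v t] that unfolding new_def by blast
    qed
    finally show "(\<Sum>v\<in>live (Suc t). length (args v)) \<le> 2 ^ R"
      using card_live_le[of t m'] card_cut_wires_le[of t m'] R by linarith
  qed
  then obtain G st where G: "computes (2 ^ R) (14 * R) G"
    and st: "\<And>v. v \<in> live (Suc t) \<Longrightarrow> st v < 2 ^ R"
    and G_st: "\<And>v f. v \<in> live (Suc t) \<Longrightarrow>
      G f (st v) = (if label C v = Add then sum_list (map f (args v)) else prod_list (map f (args v)))"
    by blast
  have val': "G (\<lambda>i. if i < 2 ^ R then F f i else 0) (st v) = val x v"
    if v: "v \<in> live (Suc t)" and f: "\<forall>i\<ge>m. f i = 0" "\<forall>i<m. f (enc i) = x i" for v f x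
  proof -
    define f' where "f' i = (if i < 2 ^ R then F f i else 0)" for i
    have f': "f' (pos v) = val x v" if "v \<in> live t" for v
      using pos[OF that] val[OF that f] by (simp add: f'_def)
    have "G f' (st v) = val x v"
    proof (cases "node_level C v \<le> t")
      case True
      then show ?thesis using G_st[OF v] f'[OF live_SucD[OF v True]] by (simp add: args_def)
    next
      case False
      then have new: "v \<in> new" using v by (simp add: new_def)
      have args: "map f' (args v) = map (\<lambda>a. val x (tail (graph C) a)) (arcs_of v)"
        using False v arcs_of(1)[of v] by (auto simp: args_def intro!: f' live_Suc_tail(1))
      have "sum_list (map f' (args v)) = (\<Sum>a\<in>in_arcs (graph C) v. val x (tail (graph C) a))"
        unfolding args sum.distinct_set_conv_list[OF arcs_of(2), of _ v, unfolded arcs_of(1)] by simp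
      moreover have "prod_list (map f' (args v)) = (\<Prod>a\<in>in_arcs (graph C) v. val x (tail (graph C) a))"
        unfolding args prod.distinct_set_conv_list[OF arcs_of(2), of _ v, unfolded arcs_of(1)] by simp
      moreover have "label C v = Add \<or> label C v = Mult"
        using new_gate(2,3)[OF new] unfolding is_input_def by (cases "label C v") auto
      ultimately show ?thesis
        using G_st[OF v, of f'] val_Add[OF new_gate(3)[OF new], of x] val_Mult[OF new_gate(3)[OF new], of x] by auto
    qed
    then show ?thesis by (simp add: f'_def[abs_def])
  qed
  have "tracks R enc (L + 14 * R) (live (Suc t)) st"
    by (rule tracksI[OF computes_comp[OF F G] st val'])
  then show ?thesis by (rule exI[of _ st])
qed

lemma tracks_live:
  assumes enc: "\<And>i. i < m \<Longrightarrow> enc i < m"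
    and R: "2 * circuit_width m C + length (outputs C) \<le> 2 ^ R"
  shows "\<exists>pos. tracks R enc (1 + 14 * R * t) (live t) pos"
proof (induction t)
  case 0
  have "m + card (live 0) \<le> 2 ^ R"
    using R card_live_le[of 0 m] inputs_le_width[of m] by linarith
  then show ?case using tracks_inputs[of enc R, OF enc] by simp
next
  case (Suc t)
  then obtain pos where "tracks R enc (1 + 14 * R * t) (live t) pos" by blast
  moreover have "m \<le> 2 ^ R" using R inputs_le_width[of m] by linarith
  ultimately have "\<exists>pos'. tracks R enc (1 + 14 * R * t + 14 * R) (live (Suc t)) pos'"
    using tracks_Suc[OF _ R] by blast
  then show ?case by (simp add: algebra_simps)
qed

text \<open>From the depth on every output is live; a last gather moves output \<open>k\<close> to
  the cell of variable \<open>k\<close>.\<close>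

lemma computes_circuit:
  assumes enc: "\<And>i. i < m \<Longrightarrow> enc i < m" "inj_on enc {..<m}"
    and R: "2 * circuit_width m C + length (outputs C) \<le> 2 ^ R"
    and "length (outputs C) \<le> m" and "circuit_depth C \<le> t"
  shows "\<exists>F. computes (2 ^ R) (1 + 14 * R * t + 10 * R) F \<and>
    (\<forall>f x. (\<forall>i\<ge>m. f i = 0) \<longrightarrow> (\<forall>i<m. f (enc i) = x i) \<longrightarrow>
      (\<forall>k<length (outputs C). F f (enc k) = circuit_output C x ! k))"
proof -
  obtain pos where "tracks R enc (1 + 14 * R * t) (live t) pos"
    using tracks_live[of enc R t, OF enc(1) R] by blast
  then obtain F where F: "computes (2 ^ R) (1 + 14 * R * t) F"
    and pos: "\<And>v. v \<in> live t \<Longrightarrow> pos v < 2 ^ R"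
    and val: "\<And>v f x. v \<in> live t \<Longrightarrow> \<forall>i\<ge>m. f i = 0 \<Longrightarrow> \<forall>i<m. f (enc i) = x i \<Longrightarrow> F f (pos v) = val x v"
    by (rule tracksE) (rule that)
  define \<phi> where "\<phi> p = (let k = inv_into {..<m} enc p in
    if k < length (outputs C) then pos (outputs C ! k) else 0)" for p
  have out: "outputs C ! k \<in> live t" if "k < length (outputs C)" for k
    using live_outputs[OF assms(5)] nth_mem[OF that] by blast
  have \<phi>: "\<phi> (enc k) = pos (outputs C ! k)" if "k < length (outputs C)" for k
    using inv_into_f_f[OF enc(2), of k] that assms(4) by (simp add: \<phi>_def)
  have "computes (2 ^ R) (10 * R) (\<lambda>f i. f (\<phi> i))"
    by (rule computes_gather) (simp add: \<phi>_def Let_def pos out)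
  note comp = computes_comp[OF F this]
  show ?thesis
  proof (intro exI conjI allI impI, rule comp)
    fix f x :: "nat \<Rightarrow> real" and k assume *: "\<forall>i\<ge>m. f i = 0" "\<forall>i<m. f (enc i) = x i" and k: "k < length (outputs C)"
    show "(if \<phi> (enc k) < 2 ^ R then F f (\<phi> (enc k)) else 0) = circuit_output C x ! k"
      unfolding \<phi>[OF k] circuit_output_nth[OF k] using pos[OF out[OF k]] val[OF out[OF k] *] by simp
  qed
qed

end

section \<open>From vectors to BaseConv models\<close>

text \<open>The offsets may vary with the column; only the layers at the two ends of a model use
  that freedom.\<close>

definition column_layer :: "nat \<Rightarrow> nat \<Rightarrow> real \<Rightarrow> (nat \<Rightarrow> nat set) \<Rightarrow> (nat \<Rightarrow> real) \<Rightarrow>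
    (nat \<Rightarrow> real) \<Rightarrow> baseconv_layer" where
  "column_layer M d c T b b' = \<lparr>conv_kind = Circular, weight = const_mat d c,
     kernel = mat M d (\<lambda>(a, j). if (M - a) mod M \<in> T j then 1 else 0),
     bias1 = mat M d (\<lambda>(i, j). b i), bias2 = mat M d (\<lambda>(i, j). b' i)\<rparr>"

lemma is_baseconv_column_layer:
  "1 \<le> d \<Longrightarrow> is_baseconv_layer (\<lambda>_. 1) (\<lambda>_. 2) M d (column_layer M d c T b b')"
  by (simp add: is_baseconv_layer_def column_layer_def const_mat_kaleidoscope[simplified])

lemma apply_column_layer:
  assumes "u \<in> carrier_mat M d" and T: "\<And>j. j < d \<Longrightarrow> T j \<subseteq> {..<M}"
  shows "apply_layer (column_layer M d c T b b') u = mat M d (\<lambda>(i, j).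
    (c * (\<Sum>j'<d. u $$ (i, j')) + b i) * ((\<Sum>t\<in>T j. u $$ ((i + t) mod M, j)) + b' i))"
proof (rule eq_matI, goal_cases)
  case (1 i j)
  then have ij: "i < M" "j < d" by auto
  have u: "dim_row u = M" "dim_col u = d" using assms(1) by auto
  let ?h = "mat M d (\<lambda>(a, j). if (M - a) mod M \<in> T j then 1 else 0) :: real mat"
  have "column_conv Circular ?h u $$ (i, j) = (\<Sum>t\<in>T j. u $$ ((i + t) mod M, j))"
    by (rule column_conv_indicator[OF T[OF ij(2)] ij assms(1)]) (use ij in auto)
  moreover have "(u * const_mat d c) $$ (i, j) = c * (\<Sum>j'<d. u $$ (i, j'))"
    using ij u by (simp add: const_mat_def scalar_prod_def sum_distrib_left mult.commute atLeast0LessThan)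
  moreover have "dim_row (column_conv Circular ?h u) = M" "dim_col (column_conv Circular ?h u) = d"
    by (simp_all add: column_conv_def u)
  moreover have "dim_row (u * const_mat d c) = M" "dim_col (u * const_mat d c) = d"
    by (simp_all add: const_mat_def u)
  ultimately show ?case using ij by (simp add: apply_layer_def column_layer_def hadamard_def)
qed (use assms(1) in \<open>auto simp: apply_layer_def column_layer_def hadamard_def\<close>)

definition uniform_columns :: "nat \<Rightarrow> nat \<Rightarrow> (nat \<Rightarrow> real) \<Rightarrow> real mat" where
  "uniform_columns M d f = mat M d (\<lambda>(i, j). f i)"

text \<open>On a matrix with \<open>d\<close> equal columns the constant weight matrix \<open>c / d\<close> acts as
  multiplication by \<open>c\<close>.\<close>

definition uniform_layer :: "nat \<Rightarrow> nat \<Rightarrow> vlayer \<Rightarrow> baseconv_layer" where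
  "uniform_layer M d = (\<lambda>(c, T, b, b'). column_layer M d (c / real d) (\<lambda>_. T) b b')"

lemma apply_uniform_layer:
  assumes "1 \<le> d" and "fst (snd l) \<subseteq> {..<M}"
  shows "apply_layer (uniform_layer M d l) (uniform_columns M d f) = uniform_columns M d (vapply M l f)"
proof -
  obtain c T b b' where l: "l = (c, T, b, b')" by (cases l)
  have "uniform_columns M d f \<in> carrier_mat M d" by (simp add: uniform_columns_def)
  then have "apply_layer (uniform_layer M d l) (uniform_columns M d f) = mat M d (\<lambda>(i, j).
    (c / real d * (\<Sum>j'<d. uniform_columns M d f $$ (i, j')) + b i) *
    ((\<Sum>t\<in>T. uniform_columns M d f $$ ((i + t) mod M, j)) + b' i))"
    unfolding l uniform_layer_def split_conv by (rule apply_column_layer) (use assms(2) l in simp)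
  also have "\<dots> = uniform_columns M d (vapply M l f)"
    using assms(1) by (intro eq_matI) (auto simp: uniform_columns_def l vapply_def)
  finally show ?thesis .
qed

lemma fold_apply_uniform_layers:
  assumes "1 \<le> d" and "\<forall>l\<in>set ls. fst (snd l) \<subseteq> {..<M}"
  shows "fold apply_layer (map (uniform_layer M d) ls) (uniform_columns M d f)
    = uniform_columns M d (fold (vapply M) ls f)"
  using assms(2) by (induction ls arbitrary: f) (simp_all add: apply_uniform_layer[OF assms(1)])

section \<open>Conversion between the input matrix and a single column\<close>

definition gather_column :: "nat \<Rightarrow> nat \<Rightarrow> real mat \<Rightarrow> nat \<Rightarrow> real" where
  "gather_column n d u i = (if i div n < d then u $$ (i mod n, i div n) else 0)"

text \<open>Shifting column \<open>j\<close> down by \<open>n * j\<close> makes the supports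
  disjoint; the weight of ones then adds the columns and leaves their sum in every column.\<close>

lemma apply_input_layers:
  assumes "1 \<le> n" and "n * d \<le> M" and u: "u \<in> carrier_mat n d"
  shows "apply_layer (column_layer M d 1 (\<lambda>_. {}) (\<lambda>_. 0) (\<lambda>_. 1))
      (apply_layer (column_layer M d 0 (\<lambda>j. {(M - n * j) mod M}) (\<lambda>_. 1) (\<lambda>_. 0)) (embed_block M d u))
    = uniform_columns M d (gather_column n d u)"
proof -
  let ?u0 = "embed_block M d u"
  let ?u1 = "mat M d (\<lambda>(i, j). if i div n = j then u $$ (i mod n, j) else 0) :: real mat"
  have du: "dim_row u = n" "dim_col u = d" using u by auto
  have "apply_layer (column_layer M d 0 (\<lambda>j. {(M - n * j) mod M}) (\<lambda>_. 1) (\<lambda>_. 0)) ?u0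
    = mat M d (\<lambda>(i, j). (0 * (\<Sum>j'<d. ?u0 $$ (i, j')) + 1) *
        ((\<Sum>t\<in>{(M - n * j) mod M}. ?u0 $$ ((i + t) mod M, j)) + 0))"
  proof (rule apply_column_layer)
    show "{(M - n * j) mod M} \<subseteq> {..<M}" if "j < d" for j
    proof -
      have "0 < M" using that assms(1,2) by (cases M) auto
      then show ?thesis by simp
    qed
  qed (simp add: embed_block_def)
  also have "\<dots> = ?u1"
  proof (rule eq_matI, goal_cases)
    case (1 i j)
    then have ij: "i < M" "j < d" by auto
    have "n * j + n \<le> n * d" using ij(2) by (metis Suc_leI add.commute mult_Suc_right mult_le_mono2)
    then have j: "n * j + n \<le> M" using assms(2) by simp
    have p: "(i + (M - n * j) mod M) mod M = (if n * j \<le> i then i - n * j else i + (M - n * j))"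
      using ij(1) j by (cases "j = 0 \<or> n = 0") (auto simp: mod_less_twice)
    have "i div n = j \<longleftrightarrow> n * j \<le> i \<and> i - n * j < n"
    proof
      assume "i div n = j"
      then have "i = n * j + i mod n" by auto
      moreover have "i mod n < n" using assms(1) by simp
      ultimately show "n * j \<le> i \<and> i - n * j < n" by linarith
    next
      assume "n * j \<le> i \<and> i - n * j < n"
      then show "i div n = j" by (intro div_nat_eqI) auto
    qed
    moreover have "i mod n = i - n * j" if "i div n = j"
      using that by (simp add: minus_mult_div_eq_mod[symmetric])
    ultimately show ?case using ij j by (auto simp: p embed_block_def du)
  qed auto
  finally have 1: "apply_layer (column_layer M d 0 (\<lambda>j. {(M - n * j) mod M}) (\<lambda>_. 1) (\<lambda>_. 0)) ?u0 = ?u1" .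
  have "apply_layer (column_layer M d 1 (\<lambda>_. {}) (\<lambda>_. 0) (\<lambda>_. 1)) ?u1
    = mat M d (\<lambda>(i, j). (1 * (\<Sum>j'<d. ?u1 $$ (i, j')) + 0) * ((\<Sum>t\<in>{}. ?u1 $$ ((i + t) mod M, j)) + 1))"
    by (rule apply_column_layer) auto
  also have "\<dots> = uniform_columns M d (gather_column n d u)"
    by (rule eq_matI) (auto simp: uniform_columns_def gather_column_def)
  finally show ?thesis unfolding 1 .
qed

lemma apply_output_layer:
  assumes "n * d \<le> M" and "i < n" and "j < d"
  shows "apply_layer (column_layer M d 0 (\<lambda>j. {n * j}) (\<lambda>_. 1) (\<lambda>_. 0)) (uniform_columns M d f) $$ (i, j)
    = f (i + n * j)"
proof -
  have less: "i + n * j < M" if "i < n" "j < d" for i j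
  proof -
    have "n * j + n \<le> n * d" using that(2) by (metis Suc_leI add.commute mult_Suc_right mult_le_mono2)
    then show ?thesis using assms(1) that(1) by linarith
  qed
  have "apply_layer (column_layer M d 0 (\<lambda>j. {n * j}) (\<lambda>_. 1) (\<lambda>_. 0)) (uniform_columns M d f)
    = mat M d (\<lambda>(i, j). (0 * (\<Sum>j'<d. uniform_columns M d f $$ (i, j')) + 1) *
        ((\<Sum>t\<in>{n * j}. uniform_columns M d f $$ ((i + t) mod M, j)) + 0))"
  proof (rule apply_column_layer)
    show "{n * j} \<subseteq> {..<M}" if "j < d" for j using less[OF _ that, of 0] assms(2) by auto
  qed (simp add: uniform_columns_def)
  then show ?thesis using less[OF assms(2,3)] assms(3) by (simp add: uniform_columns_def)
qed

text \<open>Circuit variables are numbered row by row, whereas the input layers stack the columns;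
  this formula translates.\<close>

lemma column_major_encoding:
  fixes n d :: nat
  shows "k < n * d \<Longrightarrow> k div d + n * (k mod d) < n * d"
    and "inj_on (\<lambda>k. k div d + n * (k mod d)) {..<n * d}"
    and "k < n * d \<Longrightarrow> gather_column n d u (k div d + n * (k mod d)) = u $$ (k div d, k mod d)"
proof -
  have *: "k div d < n" "k mod d < d" "(k div d + n * (k mod d)) div n = k mod d"
    "(k div d + n * (k mod d)) mod n = k div d" if "k < n * d" for k
  proof -
    have d: "0 < d" using that by (cases d) auto
    show k: "k div d < n" using that by (rule less_mult_imp_div_less)
    show "k mod d < d" using d by simp
    show "(k div d + n * (k mod d)) div n = k mod d" "(k div d + n * (k mod d)) mod n = k div d"
      using k by simp_all
  qed
  show "k div d + n * (k mod d) < n * d" if "k < n * d"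
  proof -
    have "n * (k mod d) + n \<le> n * d"
      using *(2)[OF that] by (metis Suc_leI add.commute mult_Suc_right mult_le_mono2)
    then show ?thesis using *(1)[OF that] by linarith
  qed
  show "inj_on (\<lambda>k. k div d + n * (k mod d)) {..<n * d}"
    by (rule inj_onI) (metis *(3,4) div_mult_mod_eq lessThan_iff)
  show "gather_column n d u (k div d + n * (k mod d)) = u $$ (k div d, k mod d)" if "k < n * d"
    using *[OF that] by (simp add: gather_column_def)
qed

lemma exists_power_of_two:
  assumes "1 \<le> (k :: nat)"
  obtains R where "k \<le> 2 ^ R" and "2 ^ R \<le> 2 * k"
proof -
  define R where "R = (LEAST R. k \<le> 2 ^ R)"
  have 1: "k \<le> 2 ^ R" unfolding R_def
    by (rule LeastI[of "\<lambda>r. k \<le> 2 ^ r" k]) (simp add: less_imp_le)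
  have "2 ^ R \<le> 2 * k"
  proof (cases R)
    case (Suc r)
    then have "\<not> k \<le> 2 ^ r" using not_less_Least[of r "\<lambda>R. k \<le> 2 ^ R"] unfolding R_def by simp
    then show ?thesis by (simp add: Suc)
  qed (use assms in simp)
  with 1 show ?thesis by (rule that)
qed

lemma baseconv_simulates_circuit:
  assumes "1 \<le> n" and "1 \<le> d" and C: "arithmetic_circuit (n * d) s \<Delta> w C"
    and out: "length (outputs C) \<le> n * d" and R: "3 * w \<le> 2 ^ R"
  shows "\<exists>ls. length ls \<le> 4 + 14 * R * \<Delta> + 10 * R \<and>
    is_baseconv_model (\<lambda>_. 1) (\<lambda>_. 2) n (length ls) d (6 * 2 ^ R) d ls \<and> simulates n d (6 * 2 ^ R) d ls C"
proof -
  interpret circuit C "n * d"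
    by unfold_locales (use C in \<open>simp add: arithmetic_circuit_def\<close>)
  have w: "circuit_width (n * d) C = w" and \<Delta>: "circuit_depth C \<le> \<Delta>"
    using C by (auto simp: arithmetic_circuit_def)
  have nd: "n * d \<le> w" using inputs_le_width[of "n * d"] w by simp
  define enc where "enc k = k div d + n * (k mod d)" for k
  let ?M = "6 * 2 ^ R :: nat"
  have M: "n * d \<le> ?M" using nd R by linarith
  \<comment> \<open>The factor 3 enters here: the number of outputs is at most \<open>n * d\<close>,
    hence at most \<open>w\<close>.\<close>
  have size: "2 * circuit_width (n * d) C + length (outputs C) \<le> 2 ^ R"
    using out nd R unfolding w by linarith
  have "\<exists>F. computes (2 ^ R) (1 + 14 * R * \<Delta> + 10 * R) F \<and>
    (\<forall>f x. (\<forall>i\<ge>n * d. f i = 0) \<longrightarrow> (\<forall>i<n * d. f (enc i) = x i) \<longrightarrow>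
      (\<forall>k<length (outputs C). F f (enc k) = circuit_output C x ! k))"
    unfolding enc_def
    by (rule computes_circuit[OF column_major_encoding(1,2) size out \<Delta>])
  then obtain F where F: "computes (2 ^ R) (1 + 14 * R * \<Delta> + 10 * R) F"
    and F_enc_all: "\<forall>f x. (\<forall>i\<ge>n * d. f i = 0) \<longrightarrow> (\<forall>i<n * d. f (enc i) = x i) \<longrightarrow>
      (\<forall>k<length (outputs C). F f (enc k) = circuit_output C x ! k)"
    by (elim exE conjE)
  have F_enc: "F f (enc k) = circuit_output C x ! k"
    if "\<forall>i\<ge>n * d. f i = 0" "\<forall>i<n * d. f (enc i) = x i" "k < length (outputs C)" for f x k
    using F_enc_all that by blast
  obtain vs where vs: "length vs \<le> 1 + 14 * R * \<Delta> + 10 * R" "\<forall>l\<in>set vs. fst (snd l) \<subseteq> {..<?M}"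
    and fold_vs: "\<And>f. \<forall>i\<ge>2 ^ R. f i = 0 \<Longrightarrow> fold (vapply ?M) vs f = (\<lambda>i. if i < 2 ^ R then F f i else 0)"
    using F unfolding computes_def by auto
  \<comment> \<open>The 4 in the length counts the two input layers, the output layer and the bias
    layer allowed for in \<open>vs\<close>.\<close>
  define ls where "ls = [column_layer ?M d 0 (\<lambda>j. {(?M - n * j) mod ?M}) (\<lambda>_. 1) (\<lambda>_. 0),
      column_layer ?M d 1 (\<lambda>_. {}) (\<lambda>_. 0) (\<lambda>_. 1)] @ map (uniform_layer ?M d) vs @
      [column_layer ?M d 0 (\<lambda>j. {n * j}) (\<lambda>_. 1) (\<lambda>_. 0)]"
  have "length ls \<le> 4 + 14 * R * \<Delta> + 10 * R" using vs(1) by (simp add: ls_def)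
  moreover have "is_baseconv_model (\<lambda>_. 1) (\<lambda>_. 2) n (length ls) d ?M d ls"
  proof -
    have "n \<le> n * d" using assms(2) by simp
    then have "n \<le> ?M" using M by linarith
    moreover have "is_baseconv_layer (\<lambda>_. 1) (\<lambda>_. 2) ?M d l" if "l \<in> set ls" for l
      using that is_baseconv_column_layer[OF assms(2)] unfolding ls_def uniform_layer_def
      by (auto split: prod.splits)
    ultimately show ?thesis by (simp add: is_baseconv_model_def)
  qed
  moreover have "simulates n d ?M d ls C"
    unfolding simulates_def
  proof (intro ballI allI impI)
    fix u :: "real mat" and k assume u: "u \<in> carrier_mat n d" and k: "k < length (outputs C)"
    let ?f = "gather_column n d u"
    have f0: "?f i = 0" if "n * d \<le> i" for i
    proof -
      have "d \<le> i div n" using that assms(1) by (simp add: less_eq_div_iff_mult_less_eq mult.commute)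
      then show ?thesis by (simp add: gather_column_def)
    qed
    have k': "k < n * d" using k out by simp
    have kd: "k div d < n" "k mod d < d"
      using less_mult_imp_div_less[OF k'] assms(2) by simp_all
    have enc_k: "enc k < 2 ^ R"
      using column_major_encoding(1)[OF k'] nd R unfolding enc_def by linarith
    have "fold apply_layer ls (embed_block ?M d u) = apply_layer
      (column_layer ?M d 0 (\<lambda>j. {n * j}) (\<lambda>_. 1) (\<lambda>_. 0)) (uniform_columns ?M d (fold (vapply ?M) vs ?f))"
      unfolding ls_def
      by (simp add: apply_input_layers[OF assms(1) M u] fold_apply_uniform_layers[OF assms(2) vs(2)])
    then have "model_output n d ?M d ls u $$ (k div d, k mod d) = fold (vapply ?M) vs ?f (enc k)"
      unfolding model_output_def top_left_block_def
      using kd by (simp add: apply_output_layer[OF M kd] enc_def)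
    also have "\<dots> = F ?f (enc k)"
      by (subst fold_vs) (use f0 nd R enc_k in auto)
    also have "\<dots> = circuit_output C (\<lambda>i. u $$ (i div d, i mod d)) ! k"
      by (rule F_enc[OF _ _ k]) (use f0 column_major_encoding(3) in \<open>auto simp: enc_def\<close>)
    finally show "model_output n d ?M d ls u $$ (k div d, k mod d)
      = circuit_output C (\<lambda>i. u $$ (i div d, i mod d)) ! k" .
  qed
  ultimately show ?thesis by blast
qed

lemma polylog_const: "polylog (\<lambda>_. c)"
  unfolding polylog_def by (rule exI[of _ 0]) simp

theorem theoremH21:
  shows "\<exists>\<omega> \<epsilon> :: nat \<Rightarrow> nat. \<exists>c1 c2 :: real. polylog \<omega> \<and> polylog \<epsilon> \<and>
    (\<forall>n d s \<Delta> w :: nat. \<forall>C :: arith_circuit.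
       1 \<le> n \<and> 1 \<le> d \<and> arithmetic_circuit (n * d) s \<Delta> w C \<and> length (outputs C) \<le> n * d \<longrightarrow>
       (\<exists>N \<Delta>' N' d' :: nat. \<exists>ls.
          N = n \<and>
          real \<Delta>' \<le> c1 * (max 1 (real \<Delta>) * max 1 (log 2 (real w))) \<and>
          real N' \<le> c2 * real w \<and>
          d' = d \<and>
          is_baseconv_model \<omega> \<epsilon> N \<Delta>' d N' d' ls \<and>
          simulates N d N' d' ls C))"
\<comment> \<open>36 is 6 times 6: \<open>2 ^ R\<close> is at most \<open>6 * w\<close>, and a
  column has \<open>6 * 2 ^ R\<close> cells. 100 is 4 + 14 * 4 + 10 * 4, as \<open>R\<close> is at
  most 4 times the logarithmic factor. The maxima with 1 absorb the layers that remain for depth 0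
  or width 1.\<close>
proof (rule exI[of _ "\<lambda>_. 1"], rule exI[of _ "\<lambda>_. 2"], rule exI[of _ 100], rule exI[of _ 36],
    intro conjI allI impI polylog_const)
  fix n d s \<Delta> w :: nat and C :: arith_circuit
  assume *: "1 \<le> n \<and> 1 \<le> d \<and> arithmetic_circuit (n * d) s \<Delta> w C \<and> length (outputs C) \<le> n * d"
  interpret circuit C "n * d"
    by unfold_locales (use * in \<open>simp add: arithmetic_circuit_def\<close>)
  have "n * d \<le> w" using inputs_le_width[of "n * d"] * by (simp add: arithmetic_circuit_def)
  moreover have "0 < n * d" using * by simp
  ultimately have w: "1 \<le> w" by linarith
  then obtain R where R: "3 * w \<le> 2 ^ R" "2 ^ R \<le> 2 * (3 * w)"
    using exists_power_of_two[of "3 * w"] by auto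
  obtain ls where ls: "length ls \<le> 4 + 14 * R * \<Delta> + 10 * R"
    "is_baseconv_model (\<lambda>_. 1) (\<lambda>_. 2) n (length ls) d (6 * 2 ^ R) d ls" "simulates n d (6 * 2 ^ R) d ls C"
    using baseconv_simulates_circuit[of n d s \<Delta> w C R] * R(1) by blast
  have "real (6 * 2 ^ R) \<le> 36 * real w"
  proof -
    have "6 * 2 ^ R \<le> 36 * w" using R(2) by linarith
    then show ?thesis by (metis of_nat_le_iff of_nat_mult of_nat_numeral)
  qed
  moreover have "real (length ls) \<le> 100 * (max 1 (real \<Delta>) * max 1 (log 2 (real w)))"
  proof -
    define D where "D = max 1 (real \<Delta>)"
    define \<Lambda> where "\<Lambda> = max 1 (log 2 (real w))"
    have D: "1 \<le> D" "real \<Delta> \<le> D" and \<Lambda>: "1 \<le> \<Lambda>" "log 2 (real w) \<le> \<Lambda>" by (auto simp: D_def \<Lambda>_def)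
    \<comment> \<open>Rounding 6 up to 8 makes the logarithm of the factor an integer.\<close>
    have "2 ^ R \<le> 8 * w" using R(2) by linarith
    then have "real (2 ^ R) \<le> real (8 * w)" by (rule of_nat_mono)
    then have "log 2 (2 ^ R) \<le> log 2 (8 * real w)" using w by (intro log_mono) auto
    also have "\<dots> = log 2 (2 ^ 3) + log 2 (real w)" using log_mult[of 2 8 "real w"] w by simp
    finally have "log 2 (2 ^ R) \<le> log 2 (2 ^ 3) + log 2 (real w)" .
    then have "real R \<le> 3 + log 2 (real w)" by (simp only: log_pow_cancel)
    then have R4: "real R \<le> 4 * \<Lambda>" using \<Lambda> by linarith
    have D\<Lambda>: "1 \<le> D * \<Lambda>" using D \<Lambda> mult_mono[of 1 D 1 \<Lambda>] by simp
    have "real R * real \<Delta> \<le> (4 * \<Lambda>) * D" using R4 D \<Lambda> by (intro mult_mono) auto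
    moreover have "real R * 1 \<le> (4 * \<Lambda>) * D" using R4 D \<Lambda> by (intro mult_mono) auto
    moreover have "real (length ls) \<le> 4 + 14 * (real R * real \<Delta>) + 10 * real R"
    proof -
      have "real (length ls) \<le> real (4 + 14 * R * \<Delta> + 10 * R)" using ls(1) by (rule of_nat_mono)
      then show ?thesis by (simp add: algebra_simps)
    qed
    ultimately have "real (length ls) \<le> 4 + 96 * (D * \<Lambda>)" by (simp add: algebra_simps)
    then show ?thesis using D\<Lambda> unfolding D_def[symmetric] \<Lambda>_def[symmetric] by linarith
  qed
  ultimately show "\<exists>N \<Delta>' N' d' :: nat. \<exists>ls. N = n \<and>
      real \<Delta>' \<le> 100 * (max 1 (real \<Delta>) * max 1 (log 2 (real w))) \<and> real N' \<le> 36 * real w \<and> d' = d \<and>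
      is_baseconv_model (\<lambda>_. 1) (\<lambda>_. 2) N \<Delta>' d N' d' ls \<and> simulates N d N' d' ls C"
    using ls(2,3) by blast
qed

end
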